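(* Consider a tenable balanced affine two-colour urn with multiple drawings (under model $\mathcal M$ or model $\mathcal R$), with $T_0+m(a_{m-1}-a_m)>0$, and let $\Lambda=\frac m\sigma(a_{m-1}-a_m)$ be its index. As $n\to\infty$, the variance of the number $W_n$ of white balls satisfies: (1) (small index) if $\Lambda<\frac12$: $\displaystyle \mathbb V[W_n]=\frac{a_mb_0\Lambda^2}{m(1-2\Lambda)(1-\Lambda)^2}\,n+o(n)$; (2) (critical index) if $\Lambda=\frac12$: $\displaystyle \mathbb V[W_n]=\frac{a_mb_0}{m}\,n\log n+\mathcal O(n)$; (3) (large index) if $\frac12<\Lambda<1$: $\displaystyle \mathbb V[W_n]=C\,n^{2\Lambda}+\mathcal O(n)$, with the model-dependent constant $$\begin{aligned}C&=\frac{W_0^2}{\psi_0}+\sum_{j=1}^\infty\frac{\beta_j\mathbb E[W_{j-1}]+a_m^2-2a_m\psi_j\, j^{-\Lambda}\Big(\frac{a_m}{1-\Lambda}j^{1-\Lambda}+\big(W_0-\frac{a_mT_0/\sigma}{1-\Lambda}\big)\frac{\Gamma(\frac{T_0}\sigma)}{\Gamma(\frac{T_0}\sigma+\Lambda)}\Big)}{\psi_j}\\&\quad+\frac{2a_m^2}{1-\Lambda}\zeta(2\Lambda-1)+2a_m\Big(W_0-\frac{a_mT_0/\sigma}{1-\Lambda}\Big)\frac{\Gamma(\frac{T_0}\sigma)}{\Gamma(\frac{T_0}\sigma+\Lambda)}\zeta(\Lambda)\\&\quad-\Big(W_0-\frac{a_mT_0/\sigma}{1-\Lambda}\Big)^2\frac{\Gamma^2(\frac{T_0}\sigma)}{\Gamma^2(\frac{T_0}\sigma+\Lambda)},\end{aligned}$$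 where $\zeta$ is the Riemann zeta function and $\beta_j,\psi_j$ are as defined in the context.
   Context: Urn setting. Let $m\ge1$ be an integer (sample size), and let $a_k,b_k$ ($0\le k\le m$) be integers with $a_k+b_k=\sigma$ for all $k$ (the urn is balanced), where $\sigma\ge1$. The urn starts with $W_0,B_0\in\mathbb N_0$ white and black balls, $T_0=W_0+B_0\ge m$. At step $n\ge1$ a sample of $m$ balls is drawn from the urn, which contains $W_{n-1}$ white and $B_{n-1}$ black balls; the sample is returned, and if it contained $k$ white and $m-k$ black balls, then $a_{m-k}$ white and $b_{m-k}$ black balls are added (negative numbers mean removal). Thus $T_n=W_n+B_n=T_0+\sigma n$. $\mathbb F_n$ is the $\sigma$-field generated by the first $n$ draws. Sampling models. Given $\mathbb F_{n-1}$, the probability that the $n$-th sample contains exactly $k$ white balls ($0\le k\le m$) is $\binom{W_{n-1}}{k}\binom{T_{n-1}-W_{n-1}}{m-k}\big/\binom{T_{n-1}}{m}$ in model $\mathcal M$ (without replacement) and $\binom mk W_{n-1}^k(T_{n-1}-W_{n-1})^{m-k}/T_{n-1}^m$ in model $\mathcal R$ (with replacement). Tenability: in model $\mathcal M$, $a_k\ge-(m-k)$ and $b_k\ge -k$ for $0\le k\le m$; in model $\mathcal R$, $a_k\ge-1$ for $0\le k\le m-1$, $a_m\ge0$, $b_k\ge-1$ for $1\le k\le m$, $b_0\ge0$. Affine urn: $a_k=(m-k)a_{m-1}-(m-k-1)a_m$ for $0\le k\le m$. Auxiliary quantities. Write $d=a_{m-1}-a_m$. Model $\mathcal M$: $\beta_n=d^2\big(\frac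 m{T_{n-1}}-\frac{m(m-1)}{T_{n-1}(T_{n-1}-1)}\big)+\frac{2ma_md}{T_{n-1}}+2a_m$, $\lambda_{1,2}=\frac{md+T_0-\frac12\pm\frac12\sqrt{1+4md(d+1)}}{\sigma}$, $\psi_n=\frac{\Gamma(n+\lambda_1)\Gamma(n+\lambda_2)}{\Gamma(n+\frac{T_0}\sigma)\Gamma(n+\frac{T_0-1}\sigma)}$ (for $m=1$, where $\lambda_2=\frac{T_0-1}\sigma$ when $d\ge 0$, the equal Gamma factors are cancelled and the term with $m(m-1)$ is $0$). Model $\mathcal R$: $\beta_n=\frac{d^2m}{T_{n-1}}+\frac{2ma_md}{T_{n-1}}+2a_m$, $\mu_{1,2}=\frac{md+T_0\pm d\sqrt m}{\sigma}$, $\psi_n=\frac{\Gamma(n+\mu_1)\Gamma(n+\mu_2)}{\Gamma(n+\frac{T_0}\sigma)^2}$. For both models, $\mathbb E[W_n]=\frac{a_m(n+T_0/\sigma)}{1-\Lambda}+\big(W_0-\frac{a_mT_0/\sigma}{1-\Lambda}\big)\frac{\Gamma(\frac{T_0}\sigma)\,\Gamma(n+\frac{T_0}\sigma+\Lambda)}{\Gamma(\frac{T_0}\sigma+\Lambda)\,\Gamma(n+\frac{T_0}\sigma)}$ when $\Lambda<1$. *)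

theory Defs
  imports
    "HOL-Probability.Probability"
    "HOL-Complex_Analysis.Complex_Analysis"
    "HOL-Library.Landau_Symbols"
begin

section \<open>Two-colour urns with multiple drawings\<close>

datatype drawing_model = Without_Replacement | With_Replacement

text \<open>
  The probability that a sample of size \<open>m\<close> from an urn with \<open>w\<close> white and \<open>c\<close> black balls
  contains exactly \<open>k\<close> white balls.
\<close>

fun sample_prob :: "drawing_model \<Rightarrow> nat \<Rightarrow> nat \<Rightarrow> nat \<Rightarrow> nat \<Rightarrow> real" where
  "sample_prob Without_Replacement m w c k =
     real (w choose k) * real (c choose (m - k)) / real ((w + c) choose m)"
| "sample_prob With_Replacement m w c k =
     real (m choose k) * real w ^ k * real c ^ (m - k) / real (w + c) ^ m"

definition balanced_urn :: "nat \<Rightarrow> nat \<Rightarrow> (nat \<Rightarrow> int) \<Rightarrow> (nat \<Rightarrow> int) \<Rightarrow> bool" where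
  "balanced_urn m \<sigma> a b \<longleftrightarrow> (\<forall>k\<le>m. a k + b k = int \<sigma>)"

fun tenable_urn :: "drawing_model \<Rightarrow> nat \<Rightarrow> (nat \<Rightarrow> int) \<Rightarrow> (nat \<Rightarrow> int) \<Rightarrow> bool" where
  "tenable_urn Without_Replacement m a b \<longleftrightarrow>
     (\<forall>k\<le>m. a k \<ge> - (int m - int k) \<and> b k \<ge> - int k)"
| "tenable_urn With_Replacement m a b \<longleftrightarrow>
     (\<forall>k<m. a k \<ge> -1) \<and> a m \<ge> 0 \<and> (\<forall>k. 1 \<le> k \<and> k \<le> m \<longrightarrow> b k \<ge> -1) \<and> b 0 \<ge> 0"

definition affine_urn :: "nat \<Rightarrow> (nat \<Rightarrow> int) \<Rightarrow> bool" where
  "affine_urn m a \<longleftrightarrow>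
     (\<forall>k\<le>m. a k = (int m - int k) * a (m - 1) - (int m - int k - 1) * a m)"

text \<open>
  The random variable \<open>X n\<close>, for \<open>n \<ge> 1\<close>, is the number of white balls in the \<open>n\<close>-th sample;
  \<open>X 0\<close> plays no role.
\<close>

definition draw_algebra :: "'w measure \<Rightarrow> (nat \<Rightarrow> 'w \<Rightarrow> nat) \<Rightarrow> nat \<Rightarrow> 'w measure" where
  "draw_algebra P X n = sigma (space P) {X i -` A \<inter> space P | i A. 1 \<le> i \<and> i \<le> n}"

text \<open>
  The numbers of white and black balls \<open>W n\<close> and \<open>B n\<close> are integers, so that the updates can
  be stated without truncation. Under tenability they are almost surely nonnegative, and the
  conversion \<open>nat\<close> below is then harmless.
\<close>

locale urn_process = prob_space P for P :: "'w measure" +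
  fixes model :: drawing_model
    and m :: nat
    and a b :: "nat \<Rightarrow> int"
    and W\<^sub>0 B\<^sub>0 :: nat
    and X :: "nat \<Rightarrow> 'w \<Rightarrow> nat"
    and W B :: "nat \<Rightarrow> 'w \<Rightarrow> int"
  assumes draw_measurable: "X (Suc n) \<in> P \<rightarrow>\<^sub>M count_space {0..m}"
    and white_0: "\<omega> \<in> space P \<Longrightarrow> W 0 \<omega> = int W\<^sub>0"
    and black_0: "\<omega> \<in> space P \<Longrightarrow> B 0 \<omega> = int B\<^sub>0"
    and white_Suc: "\<omega> \<in> space P \<Longrightarrow> W (Suc n) \<omega> = W n \<omega> + a (m - X (Suc n) \<omega>)"
    and black_Suc: "\<omega> \<in> space P \<Longrightarrow> B (Suc n) \<omega> = B n \<omega> + b (m - X (Suc n) \<omega>)"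
    and draw_law: "k \<le> m \<Longrightarrow>
      AE \<omega> in P. real_cond_exp P (draw_algebra P X n)
                   (indicator {\<omega> \<in> space P. X (Suc n) \<omega> = k}) \<omega>
               = sample_prob model m (nat (W n \<omega>)) (nat (B n \<omega>)) k"


section \<open>The constants in the variance asymptotics\<close>

definition urn_diff :: "nat \<Rightarrow> (nat \<Rightarrow> int) \<Rightarrow> real" where
  "urn_diff m a = real_of_int (a (m - 1) - a m)"

definition urn_index :: "nat \<Rightarrow> nat \<Rightarrow> (nat \<Rightarrow> int) \<Rightarrow> real" where
  "urn_index m \<sigma> a = real m / real \<sigma> * urn_diff m a"

fun urn_beta :: "drawing_model \<Rightarrow> nat \<Rightarrow> nat \<Rightarrow> (nat \<Rightarrow> int) \<Rightarrow> nat \<Rightarrow> nat \<Rightarrow> real" where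
  "urn_beta Without_Replacement m \<sigma> a T\<^sub>0 n =
     (let d = urn_diff m a; a\<^sub>m = real_of_int (a m); T = real T\<^sub>0 + real \<sigma> * (real n - 1)
      in d\<^sup>2 * (m / T - m * (real m - 1) / (T * (T - 1))) + 2 * m * a\<^sub>m * d / T + 2 * a\<^sub>m)"
| "urn_beta With_Replacement m \<sigma> a T\<^sub>0 n =
     (let d = urn_diff m a; a\<^sub>m = real_of_int (a m); T = real T\<^sub>0 + real \<sigma> * (real n - 1)
      in d\<^sup>2 * m / T + 2 * m * a\<^sub>m * d / T + 2 * a\<^sub>m)"

text \<open>
  Without replacement and with \<open>m = 1\<close>, the radicand is \<open>(2 * d + 1)\<^sup>2\<close>, so one of
  \<open>l\<^sub>1\<close>, \<open>l\<^sub>2\<close> is \<open>(T\<^sub>0 - 1) / \<sigma>\<close> and the other is \<open>(2 * d + T\<^sub>0) / \<sigma>\<close>. The common Gamma factor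
  has to be cancelled explicitly, since for \<open>T\<^sub>0 = 1\<close> and \<open>n = 0\<close> it sits at a pole.
\<close>

fun urn_psi :: "drawing_model \<Rightarrow> nat \<Rightarrow> nat \<Rightarrow> (nat \<Rightarrow> int) \<Rightarrow> nat \<Rightarrow> nat \<Rightarrow> real" where
  "urn_psi Without_Replacement m \<sigma> a T\<^sub>0 n =
     (let d = urn_diff m a;
          r = sqrt (1 + 4 * m * d * (d + 1));
          l\<^sub>1 = (m * d + T\<^sub>0 - 1/2 + 1/2 * r) / \<sigma>;
          l\<^sub>2 = (m * d + T\<^sub>0 - 1/2 - 1/2 * r) / \<sigma>
      in if m = 1 then Gamma (n + (2 * d + T\<^sub>0) / \<sigma>) / Gamma (n + T\<^sub>0 / \<sigma>)
         else Gamma (n + l\<^sub>1) * Gamma (n + l\<^sub>2)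
              / (Gamma (n + T\<^sub>0 / \<sigma>) * Gamma (n + (real T\<^sub>0 - 1) / \<sigma>)))"
| "urn_psi With_Replacement m \<sigma> a T\<^sub>0 n =
     (let d = urn_diff m a;
          \<mu>\<^sub>1 = (m * d + T\<^sub>0 + d * sqrt m) / \<sigma>;
          \<mu>\<^sub>2 = (m * d + T\<^sub>0 - d * sqrt m) / \<sigma>
      in Gamma (n + \<mu>\<^sub>1) * Gamma (n + \<mu>\<^sub>2) / (Gamma (n + T\<^sub>0 / \<sigma>))\<^sup>2)"

text \<open>
  The Riemann zeta function: the value at \<open>s \<noteq> 1\<close> of the analytic continuation of the Dirichlet
  series to a half-plane containing \<open>s\<close>, with the point \<open>1\<close> removed. Punctured half-planes are
  connected, and so are their intersections, so the value depends neither on the half-plane nor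
  on \<open>f\<close>. The value at \<open>s = 1\<close> is unspecified.
\<close>

definition zeta :: "complex \<Rightarrow> complex" where
  "zeta s = (THE z. \<exists>c f. c < Re s \<and> f holomorphic_on ({w. c < Re w} - {1}) \<and>
               (\<forall>w. Re w > 1 \<longrightarrow> (\<lambda>n. 1 / of_nat (Suc n) powr w) sums f w) \<and> z = f s)"

definition urn_mean_coeff :: "nat \<Rightarrow> nat \<Rightarrow> (nat \<Rightarrow> int) \<Rightarrow> nat \<Rightarrow> nat \<Rightarrow> real" where
  "urn_mean_coeff m \<sigma> a W\<^sub>0 T\<^sub>0 =
     (let \<Lambda> = urn_index m \<sigma> a
      in (W\<^sub>0 - (a m * T\<^sub>0 / \<sigma>) / (1 - \<Lambda>)) * (Gamma (T\<^sub>0 / \<sigma>) / Gamma (T\<^sub>0 / \<sigma> + \<Lambda>)))"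

text \<open>In the following two definitions, \<open>E n\<close> stands for the expectation of \<open>W n\<close>.\<close>

definition large_index_summand ::
    "drawing_model \<Rightarrow> nat \<Rightarrow> nat \<Rightarrow> (nat \<Rightarrow> int) \<Rightarrow> nat \<Rightarrow> nat \<Rightarrow> (nat \<Rightarrow> real) \<Rightarrow> nat \<Rightarrow> real" where
  "large_index_summand model m \<sigma> a W\<^sub>0 T\<^sub>0 E j =
     (let \<Lambda> = urn_index m \<sigma> a;
          a\<^sub>m = real_of_int (a m);
          \<psi> = urn_psi model m \<sigma> a T\<^sub>0 j
      in (urn_beta model m \<sigma> a T\<^sub>0 j * E (j - 1) + a\<^sub>m\<^sup>2
          - 2 * a\<^sub>m * \<psi> * j powr (-\<Lambda>)
              * (a\<^sub>m / (1 - \<Lambda>) * j powr (1 - \<Lambda>) + urn_mean_coeff m \<sigma> a W\<^sub>0 T\<^sub>0)) / \<psi>)"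

definition large_index_constant ::
    "drawing_model \<Rightarrow> nat \<Rightarrow> nat \<Rightarrow> (nat \<Rightarrow> int) \<Rightarrow> nat \<Rightarrow> nat \<Rightarrow> (nat \<Rightarrow> real) \<Rightarrow> real" where
  "large_index_constant model m \<sigma> a W\<^sub>0 T\<^sub>0 E =
     (let \<Lambda> = urn_index m \<sigma> a;
          a\<^sub>m = real_of_int (a m);
          K = urn_mean_coeff m \<sigma> a W\<^sub>0 T\<^sub>0
      in (real W\<^sub>0)\<^sup>2 / urn_psi model m \<sigma> a T\<^sub>0 0
         + (\<Sum>j. large_index_summand model m \<sigma> a W\<^sub>0 T\<^sub>0 E (Suc j))
         + 2 * a\<^sub>m\<^sup>2 / (1 - \<Lambda>) * Re (zeta (of_real (2 * \<Lambda> - 1)))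
         + 2 * a\<^sub>m * K * Re (zeta (of_real \<Lambda>))
         - K\<^sup>2)"

end

theory Submission
  imports Defs "HOL-Real_Asymp.Real_Asymp"
begin

text \<open>
  Affinity makes each step \<open>W\<^sub>n\<^sub>+\<^sub>1 = W\<^sub>n + a\<^sub>m + d X\<^sub>n\<^sub>+\<^sub>1\<close>, where \<open>X\<^sub>n\<^sub>+\<^sub>1\<close> is
  hypergeometric or binomial given the past, so the first two moments \<open>M\<^sub>n\<close>, \<open>S\<^sub>n\<close> of
  \<open>W\<^sub>n\<close> satisfy linear recursions. The deviation of \<open>M\<^sub>n\<close> from the equilibrium proportion of
  \<open>T\<^sub>n\<close> is an exact Gamma quotient of order \<open>n\<^sup>\<Lambda>\<close>. The variance satisfies
  \<open>V\<^sub>n\<^sub>+\<^sub>1 = \<alpha>\<^sub>n V\<^sub>n + r\<^sub>n\<close> with \<open>\<alpha>\<^sub>n = 1 + 2 \<Lambda> / n + \<dots>\<close> and \<open>r\<^sub>n \<longlonglongrightarrow> \<rho>\<close>. For small index this forces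
  \<open>V\<^sub>n\<close> to be close to \<open>\<rho> n / (1 - 2 \<Lambda>)\<close>; for critical index the increments of \<open>V\<^sub>n / \<psi>\<^sub>n\<close> are those of
  \<open>\<rho> ln n\<close> up to a summable error, where \<open>\<psi>\<^sub>n\<^sub>+\<^sub>1 = \<alpha>\<^sub>n \<psi>\<^sub>n\<close>. For large index \<open>S\<^sub>n / \<psi>\<^sub>n\<close> is a partial sum
  whose divergent part consists of \<open>\<Sum> k\<^sup>1\<^sup>-\<^sup>2\<^sup>\<Lambda>\<close> and \<open>\<Sum> k\<^sup>-\<^sup>\<Lambda>\<close>; their expansions contribute the
  zeta values, and their growing terms cancel against \<open>M\<^sub>n\<^sup>2\<close>.
\<close>

section \<open>Moments of a sample\<close>

text \<open>Both \<open>S n\<close> and the square of \<open>M n\<close> can be of order n^2 while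
  the variance is o(n^2). Up to the critical index the recursion is therefore passed to the variance
  itself. Its inhomogeneity is \<open>d^2\<close> times the conditional variance of a draw with the
  white count replaced by its mean; this explains the limit \<open>d^2 * m * p * (1 - p)\<close>
  and, as \<open>p = a\<^sub>m / (a\<^sub>m + b 0)\<close>, the product of \<open>a\<^sub>m\<close>
  and \<open>b 0\<close> in the constants. For a large index the constant is expressed through
  second moments, so \<open>S\<close> is kept and the cancellation is carried out on explicit terms.
  For a small index one cannot divide by a homogeneous solution: \<open>\<alpha> 0\<close> may
  vanish (\<open>m = 2\<close>, \<open>d = -1\<close>, three balls, without replacement), so a
  comparison argument is used. From the critical index on \<open>d > 0\<close>, which makes all
  Gamma parameters of \<open>urn_psi\<close> positive; the drift hypothesis does the same for the
  mean. The law of the draws is given almost surely and through \<open>nat\<close>, so tenability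
  must first be turned into nonnegativity. \<open>zeta\<close> is a definite description, so its
  values left of 1 must be identified by an explicit continuation.\<close>

text \<open>Absorption removes one factor \<open>k\<close> together with one white ball and one
  draw. The free weight \<open>f\<close> allows the identity to be applied twice.\<close>

lemma hypergeometric_absorption:
  fixes f :: "nat \<Rightarrow> real"
  shows "(\<Sum>k\<le>Suc m. real k * f k * (real (w choose k) * real (c choose (Suc m - k))))
    = real w * (\<Sum>k\<le>m. f (Suc k) * (real ((w - 1) choose k) * real (c choose (m - k))))"
proof -
  have absorb: "real (Suc k) * real (w choose Suc k) = real w * real ((w - 1) choose k)" for k
    by (metis binomial_absorption of_nat_mult)
  have "real (Suc k) * f (Suc k) * (real (w choose Suc k) * x)
    = real w * (f (Suc k) * (real ((w - 1) choose k) * x))" for k x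
    using arg_cong[OF absorb[of k], of "\<lambda>y. f (Suc k) * x * y"] by (simp only: mult_ac)
  then show ?thesis
    by (subst sum.atMost_Suc_shift)
      (simp only: diff_Suc_Suc sum_distrib_left of_nat_0 mult_zero_left add_0_left)
qed

text \<open>The analogue for independent draws: one trial is removed, while the colour weights
  \<open>x\<close> and \<open>y\<close> stay unchanged.\<close>

lemma binomial_weights_absorption:
  fixes f :: "nat \<Rightarrow> real"
  shows "(\<Sum>k\<le>Suc m. real k * f k * (real (Suc m choose k) * x ^ k * y ^ (Suc m - k)))
    = real (Suc m) * x * (\<Sum>k\<le>m. f (Suc k) * (real (m choose k) * x ^ k * y ^ (m - k)))"
proof -
  have absorb: "real (Suc k) * real (Suc m choose Suc k) = real (Suc m) * real (m choose k)" for k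
    by (metis Suc_times_binomial of_nat_mult)
  have "real (Suc k) * f (Suc k) * (real (Suc m choose Suc k) * x ^ Suc k * z)
    = real (Suc m) * x * (f (Suc k) * (real (m choose k) * x ^ k * z))" for k z
    using arg_cong[OF absorb[of k], of "\<lambda>y. f (Suc k) * x ^ Suc k * z * y"]
    by (simp only: power_Suc mult_ac)
  then show ?thesis
    by (subst sum.atMost_Suc_shift)
      (simp only: diff_Suc_Suc sum_distrib_left of_nat_0 mult_zero_left add_0_left)
qed

lemma hypergeometric_total:
  "(\<Sum>k\<le>m. real (w choose k) * real (c choose (m - k))) = real ((w + c) choose m)"
  by (metis (no_types, lifting) of_nat_mult of_nat_sum sum.cong vandermonde)

lemma sample_prob_mean:
  assumes "m \<ge> 1" "w + c \<ge> m"
  shows "(\<Sum>k\<le>m. real k * sample_prob model m w c k) = real m * real w / real (w + c)"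
proof -
  obtain m' where m: "m = Suc m'"
    using assms by (cases m) auto
  have pos: "real (w + c) > 0"
    using assms by auto
  show ?thesis
  proof (cases model)
    case Without_Replacement
    have "(\<Sum>k\<le>m. real k * sample_prob model m w c k)
      = (\<Sum>k\<le>Suc m'. real k * 1 * (real (w choose k) * real (c choose (Suc m' - k)))) / real ((w + c) choose m)"
      by (simp add: Without_Replacement m sum_divide_distrib[symmetric] del: sum.atMost_Suc)
    also have "\<dots> = real w * real ((w - 1 + c) choose m') / real ((w + c) choose m)"
      by (simp only: hypergeometric_absorption mult_1_left hypergeometric_total)
    also have "\<dots> = real m * real w / real (w + c)"
    \<comment> \<open>For \<open>w = 0\<close> truncated subtraction makes \<open>w - 1 + c\<close>
      differ from \<open>w + c - 1\<close>, but then both sides vanish.\<close>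
    proof (cases "w = 0")
      case False
      then have "real m * real ((w + c) choose m) = real (w + c) * real ((w - 1 + c) choose m')"
        using binomial_absorption[of m' "w + c"] m
        by (metis Nat.add_diff_assoc2 One_nat_def Suc_leI neq0_conv of_nat_mult)
      moreover have "real ((w + c) choose m) > 0"
        using assms by simp
      ultimately show ?thesis
        using pos by (simp add: field_simps del: of_nat_add)
    qed auto
    finally show ?thesis .
  next
    case With_Replacement
    have "(\<Sum>k\<le>m. real k * sample_prob model m w c k)
      = (\<Sum>k\<le>Suc m'. real k * 1 * (real (Suc m' choose k) * real w ^ k * real c ^ (Suc m' - k))) / real (w + c) ^ m"
      by (simp add: With_Replacement m sum_divide_distrib[symmetric] mult.assoc del: sum.atMost_Suc binomial_Suc_Suc)
    also have "\<dots> = real m * real w * real (w + c) ^ m' / real (w + c) ^ m"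
      unfolding binomial_weights_absorption
      using binomial_ring[of "real w" "real c" m'] m
      by (simp add: atLeast0AtMost)
    finally show ?thesis
      using pos m by simp
  qed
qed

text \<open>
  For \<open>w\<close> white balls among \<open>T\<close>, the expected number of ordered pairs of white balls in the
  sample is \<open>pair_coeff * w\<^sup>2 - same_ball_coeff * w\<close>: only without replacement are pairs
  of equal balls excluded.
\<close>

definition pair_coeff :: "drawing_model \<Rightarrow> nat \<Rightarrow> real \<Rightarrow> real" where
  "pair_coeff model m T = (case model of
     Without_Replacement \<Rightarrow> real m * (real m - 1) / (T * (T - 1))
   | With_Replacement \<Rightarrow> real m * (real m - 1) / T\<^sup>2)"

definition same_ball_coeff :: "drawing_model \<Rightarrow> nat \<Rightarrow> real \<Rightarrow> real" where
  "same_ball_coeff model m T = (case model of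
     Without_Replacement \<Rightarrow> real m * (real m - 1) / (T * (T - 1))
   | With_Replacement \<Rightarrow> 0)"

text \<open>Two absorptions strip both factors: the index shift of the first one turns the weight
  \<open>k - 1\<close> into \<open>k\<close>, ready for the second. Removing two draws needs
  \<open>m\<close> at least 2; for \<open>m = 1\<close> every term is zero.\<close>

lemma sample_prob_second_factorial_moment:
  assumes "m \<ge> 1" "w + c \<ge> m"
  shows "(\<Sum>k\<le>m. real k * (real k - 1) * sample_prob model m w c k)
    = pair_coeff model m (real (w + c)) * (real w)\<^sup>2 - same_ball_coeff model m (real (w + c)) * real w"
proof (cases "m = 1")
  case True
  then show ?thesis
    by (simp add: pair_coeff_def same_ball_coeff_def split: drawing_model.split)
next
  case False
  then have "m = Suc (Suc (m - 2))"
    using assms(1) by simp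
  then obtain m' where m: "m = Suc (Suc m')" ..
  have T: "real (w + c) \<ge> 2"
    using assms m by linarith
  show ?thesis
  proof (cases model)
    case Without_Replacement
    have "(\<Sum>k\<le>m. real k * (real k - 1) * sample_prob model m w c k)
      = (\<Sum>k\<le>Suc (Suc m'). real k * (real k - 1) * (real (w choose k) * real (c choose (Suc (Suc m') - k))))
        / real ((w + c) choose m)"
      unfolding sum_divide_distrib by (simp only: Without_Replacement sample_prob.simps m times_divide_eq_right)
    also have "\<dots> = real w * (\<Sum>k\<le>Suc m'. real k * 1 * (real ((w - 1) choose k) * real (c choose (Suc m' - k))))
        / real ((w + c) choose m)"
      by (simp only: hypergeometric_absorption[of "\<lambda>k. real k - 1"] of_nat_Suc add_diff_cancel_left' mult_1_right)
    also have "\<dots> = real w * (real (w - 1) * real ((w - 2 + c) choose m')) / real ((w + c) choose m)"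
      by (simp only: hypergeometric_absorption mult_1_left hypergeometric_total diff_diff_left one_add_one)
    also have "\<dots> = real m * (real m - 1) * real w * (real w - 1) / (real (w + c) * (real (w + c) - 1))"
    proof (cases "w \<le> 1")
      case True
      then show ?thesis by (cases w) auto
    next
      case False
      then have "w = Suc (Suc (w - 2))"
        by simp
      then obtain v where v: "w = Suc (Suc v)" ..
      have 1: "real (Suc (Suc m')) * real ((w + c) choose Suc (Suc m')) = real (w + c) * real (Suc (v + c) choose Suc m')"
      proof -
        have "w + c - 1 = Suc (v + c)"
          using v by simp
        then show ?thesis
          by (metis binomial_absorption of_nat_mult)
      qed
      have 2: "real (Suc m') * real (Suc (v + c) choose Suc m') = real (Suc (v + c)) * real ((v + c) choose m')"
        by (metis Suc_times_binomial of_nat_mult)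
      have 3: "real (w + c) - 1 = real (Suc (v + c))" "real m - 1 = real (Suc m')" "real w - 1 = real (w - 1)" "w - 2 + c = v + c"
        using v m by auto
      have 4: "real ((w + c) choose m) > 0"
        using assms by simp
      have "real ((v + c) choose m') = real m * real (Suc m') * real ((w + c) choose m) / (real (w + c) * real (Suc (v + c)))"
      proof -
        have "real (w + c) * real (Suc (v + c)) * real ((v + c) choose m')
          = real (w + c) * (real (Suc m') * real (Suc (v + c) choose Suc m'))"
          by (simp only: 2 mult_ac)
        also have "\<dots> = real (Suc m') * (real m * real ((w + c) choose m))"
          by (simp only: 1 m mult_ac)
        finally have "real (w + c) * real (Suc (v + c)) * real ((v + c) choose m')
          = real m * real (Suc m') * real ((w + c) choose m)"
          by (simp only: mult_ac)
        moreover have "real (w + c) * real (Suc (v + c)) \<noteq> 0"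
          using T by auto
        ultimately show ?thesis
          by (intro eq_divide_imp) (simp_all only: mult.commute not_False_eq_True)
      qed
      then show ?thesis
        unfolding 3 using 4 by (simp del: of_nat_Suc of_nat_add)
    qed
    also have "\<dots> = pair_coeff model m (real (w + c)) * (real w)\<^sup>2 - same_ball_coeff model m (real (w + c)) * real w"
    proof -
      have "q * v * (v - 1) / D = q / D * v\<^sup>2 - q / D * v" for q v D :: real
        by (simp add: power2_eq_square right_diff_distrib diff_divide_distrib)
      then show ?thesis
        by (simp only: Without_Replacement pair_coeff_def same_ball_coeff_def drawing_model.case)
    qed
    finally show ?thesis .
  next
    case With_Replacement
    have "(\<Sum>k\<le>m. real k * (real k - 1) * sample_prob model m w c k)
      = (\<Sum>k\<le>Suc (Suc m'). real k * (real k - 1) * (real (Suc (Suc m') choose k) * real w ^ k * real c ^ (Suc (Suc m') - k))) / real (w + c) ^ m"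
      unfolding sum_divide_distrib by (simp only: With_Replacement sample_prob.simps m times_divide_eq_right)
    also have "\<dots> = real m * real w * (\<Sum>k\<le>Suc m'. real k * 1 * (real (Suc m' choose k) * real w ^ k * real c ^ (Suc m' - k))) / real (w + c) ^ m"
      unfolding binomial_weights_absorption[of "\<lambda>k. real k - 1"] unfolding m by simp
    also have "\<dots> = real m * real w * ((real m - 1) * real w * real (w + c) ^ m') / real (w + c) ^ m"
      unfolding binomial_weights_absorption of_nat_add binomial_ring m by simp
    also have "real (w + c) ^ m = (real (w + c))\<^sup>2 * real (w + c) ^ m'"
      by (simp add: m power2_eq_square)
    finally show ?thesis
      using T by (simp add: With_Replacement pair_coeff_def same_ball_coeff_def power2_eq_square mult_ac del: of_nat_add)
  qed
qed

section \<open>Asymptotics of Gamma quotients\<close>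

text \<open>The difference on the right is asymptotic to \<open>(s - 1) * n powr (-s)\<close>; the
  factor 2 leaves room for the inequality to hold eventually. It replaces integral comparison when
  tails of power series are estimated.\<close>

lemma powr_telescope_bound:
  fixes s :: real
  assumes "s > 1"
  shows "eventually (\<lambda>n. real n powr (-s) \<le> 2 / (s - 1) * (real n powr (1 - s) - real (Suc n) powr (1 - s))) sequentially"
proof -
  have "((\<lambda>n. real n powr s * (real n powr (1 - s) - real (Suc n) powr (1 - s))) \<longlongrightarrow> s - 1) sequentially"
    by real_asymp
  then have "eventually (\<lambda>n. real n powr s * (real n powr (1 - s) - real (Suc n) powr (1 - s)) > (s - 1) / 2) sequentially"
    by (rule order_tendstoD) (use assms in auto)
  then show ?thesis
    using eventually_gt_at_top[of 0]
  proof eventually_elim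
    case (elim n)
    then have "real n powr (-s) * ((s - 1) / 2) \<le> real n powr (-s) * (real n powr s * (real n powr (1 - s) - real (Suc n) powr (1 - s)))"
      by (intro mult_left_mono) auto
    also have "\<dots> = real n powr (1 - s) - real (Suc n) powr (1 - s)"
      using elim by (simp add: mult.assoc[symmetric] powr_add[symmetric])
    finally show ?case
      using assms by (simp add: field_simps)
  qed
qed

text \<open>Turns the size of increments into a rate of convergence. The rates for Gamma quotients,
  for zeta sums and for the tail of the series in the large-index constant all come from here. The
  majorant \<open>w\<close> is chosen so that its own decrements dominate the increments of
  \<open>h\<close>.\<close>

lemma bigo_of_increments:
  fixes h :: "nat \<Rightarrow> real"
  assumes lim: "h \<longlonglongrightarrow> L" and s: "s > 1"
    and incr: "(\<lambda>n. h (Suc n) - h n) \<in> O(\<lambda>n. real n powr (-s))"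
  shows "(\<lambda>n. h n - L) \<in> O(\<lambda>n. real n powr (1 - s))"
proof -
  obtain c where c: "c > 0" "eventually (\<lambda>n. norm (h (Suc n) - h n) \<le> c * norm (real n powr (-s))) sequentially"
    using incr by (rule landau_o.bigE)
  define w where "w n = c * 2 / (s - 1) * real n powr (1 - s)" for n :: nat
  have "eventually (\<lambda>n. \<bar>h (Suc n) - h n\<bar> \<le> w n - w (Suc n)) sequentially"
    using c(2) powr_telescope_bound[OF s]
  proof eventually_elim
    case (elim n)
    have "\<bar>h (Suc n) - h n\<bar> \<le> c * real n powr (-s)"
      using elim(1) by simp
    also have "\<dots> \<le> c * (2 / (s - 1) * (real n powr (1 - s) - real (Suc n) powr (1 - s)))"
      using elim(2) c(1) by (intro mult_left_mono) auto
    finally show ?case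
      by (simp add: w_def algebra_simps)
  qed
  then obtain N where N: "\<And>n. n \<ge> N \<Longrightarrow> \<bar>h (Suc n) - h n\<bar> \<le> w n - w (Suc n)"
    by (auto simp: eventually_sequentially)
  have w: "w \<longlonglongrightarrow> 0"
    unfolding w_def using s by real_asymp
  have "\<bar>h n - L\<bar> \<le> w n" if n: "n \<ge> N" for n
  proof -
    \<comment> \<open>\<open>h + w\<close> decreases and \<open>h - w\<close> increases to the common limit \<open>L\<close>.\<close>
    have "decseq (\<lambda>k. h (k + n) + w (k + n))"
      using N n by (intro decseq_SucI) (smt (verit) add_Suc trans_le_add2)
    moreover have "(\<lambda>k. h (k + n) + w (k + n)) \<longlonglongrightarrow> L + 0"
      using lim w by (intro tendsto_add LIMSEQ_ignore_initial_segment)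
    ultimately have "L + 0 \<le> h (0 + n) + w (0 + n)"
      by (rule decseq_ge)
    moreover have "incseq (\<lambda>k. h (k + n) - w (k + n))"
      using N n by (intro incseq_SucI) (smt (verit) add_Suc trans_le_add2)
    moreover have "(\<lambda>k. h (k + n) - w (k + n)) \<longlonglongrightarrow> L - 0"
      using lim w by (intro tendsto_diff LIMSEQ_ignore_initial_segment)
    ultimately show ?thesis
      using incseq_le[of "\<lambda>k. h (k + n) - w (k + n)" "L - 0" 0] by simp
  qed
  then have "h - (\<lambda>_. L) \<in> O(w)"
    by (intro landau_o.bigI[of 1]) (auto simp: eventually_sequentially intro!: exI[of _ N] intro: order_trans[OF _ abs_ge_self])
  also have "w \<in> O(\<lambda>n. real n powr (1 - s))"
    using s c(1) unfolding w_def by (intro bigoI[of _ "c * 2 / (s - 1)"]) auto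
  finally show ?thesis
    by (simp add: fun_diff_def)
qed

lemma convergent_of_increments:
  fixes h :: "nat \<Rightarrow> real"
  assumes s: "s > 1" and incr: "(\<lambda>n. h (Suc n) - h n) \<in> O(\<lambda>n. real n powr (-s))"
  shows "convergent h"
proof -
  have "summable (\<lambda>n. h (Suc n) - h n)"
    by (rule summable_comparison_test_bigo[OF _ incr]) (use s in \<open>simp add: summable_real_powr_iff\<close>)
  then have "convergent (\<lambda>n. (\<Sum>k<n. h (Suc k) - h k) + h 0)"
    by (intro convergent_add) (auto simp: summable_iff_convergent convergent_const)
  then show ?thesis
    by (simp add: sum_lessThan_telescope)
qed

lemma Gamma_shift_Suc:
  fixes z :: real
  assumes "z > 0"
  shows "Gamma (real (Suc n) + z) = (real n + z) * Gamma (real n + z)"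
proof -
  have "real n + z \<noteq> 0"
    using assms by linarith
  then show ?thesis
    using Gamma_plus1[of "real n + z"] assms
    by (metis add.commute add.left_commute add_pos_nonneg nonpos_Ints_nonpos not_less of_nat_0_le_iff of_nat_Suc)
qed

text \<open>Quotient of the two Euler limits \<open>Gamma_series\<close> at \<open>y\<close> and at
  \<open>x\<close>: the factorials cancel, and the rising factorials become Gamma values.\<close>

lemma Gamma_ratio_tendsto:
  fixes x y :: real
  assumes "x > 0" "y > 0"
  shows "(\<lambda>n. Gamma (real n + x) / Gamma (real n + y) * real n powr (y - x)) \<longlonglongrightarrow> 1"
proof -
  have nonpos: "x \<notin> \<int>\<^sub>\<le>\<^sub>0" "y \<notin> \<int>\<^sub>\<le>\<^sub>0"
    using assms by (auto elim: nonpos_Ints_cases)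
  have pos: "Gamma x > 0" "Gamma y > 0"
    using assms by auto
  \<comment> \<open>\<open>Gamma_series z n\<close> involves \<open>Gamma (n + 1 + z)\<close>; the
    last factor, which tends to 1, lowers these arguments to \<open>n + x\<close> and
    \<open>n + y\<close>.\<close>
  have "(\<lambda>n. Gamma_series y n / Gamma_series x n * (Gamma x / Gamma y) * ((real n + y) / (real n + x)))
      \<longlonglongrightarrow> Gamma y / Gamma x * (Gamma x / Gamma y) * 1"
  proof (intro tendsto_mult tendsto_divide Gamma_series_LIMSEQ tendsto_const)
    show "(\<lambda>n. (real n + y) / (real n + x)) \<longlonglongrightarrow> 1"
      by real_asymp
  qed (use pos in auto)
  also have "Gamma y / Gamma x * (Gamma x / Gamma y) * 1 = 1"
    using pos by simp
  finally show ?thesis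
  proof (rule Lim_transform_eventually)
    show "eventually (\<lambda>n. Gamma_series y n / Gamma_series x n * (Gamma x / Gamma y) * ((real n + y) / (real n + x))
      = Gamma (real n + x) / Gamma (real n + y) * real n powr (y - x)) sequentially"
      using eventually_gt_at_top[of 0]
    proof eventually_elim
      case (elim n)
      have series: "Gamma_series z n = fact n * exp (z * ln (real n)) * Gamma z / ((real n + z) * Gamma (real n + z))"
        if "z > 0" for z :: real
      proof -
        have "z \<notin> \<int>\<^sub>\<le>\<^sub>0"
          using that by (auto elim: nonpos_Ints_cases)
        then have "pochhammer z (n + 1) = Gamma (real (Suc n) + z) / Gamma z"
          using pochhammer_Gamma[of z "n + 1"] by (simp add: add_ac)
        then show ?thesis
          unfolding Gamma_series_def Gamma_shift_Suc[OF that] by simp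
      qed
      have exp_y: "exp (y * ln (real n)) = real n powr (y - x) * exp (x * ln (real n))"
        using elim by (simp add: powr_def exp_add[symmetric] algebra_simps)
      have cancel: "f * (p * e) * gy / (v * ry) / (f * e * gx / (u * rx)) * (gx / gy) * (v / u) = rx / ry * p"
        if "f \<noteq> 0" "e \<noteq> 0" "gx \<noteq> 0" "gy \<noteq> 0" "u \<noteq> 0" "v \<noteq> 0" "rx \<noteq> 0" "ry \<noteq> 0"
        for f p e gx gy u v rx ry :: real
        using that by (simp add: divide_simps)
      have "real n + x > 0" "real n + y > 0"
        using assms by auto
      then have nz: "real n + x \<noteq> 0" "real n + y \<noteq> 0" "Gamma (real n + x) \<noteq> 0" "Gamma (real n + y) \<noteq> 0"
        by (metis Gamma_real_pos less_irrefl)+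
      then show ?case
        unfolding series[OF assms(1)] series[OF assms(2)] exp_y
        using pos by (intro cancel) (fact nz | simp)+
    qed
  qed
qed

text \<open>The normalised quotient \<open>g\<close> tends to 1, and in its relative increment
  \<open>q\<close> the two terms of order 1/n, from the functional equation and from the power,
  cancel. Increments of order n^-2 then give the error 1/n.\<close>

lemma Gamma_ratio_asymp:
  fixes x y :: real
  assumes "x > 0" "y > 0"
  shows "(\<lambda>n. Gamma (real n + x) / Gamma (real n + y) - real n powr (x - y)) \<in> O(\<lambda>n. real n powr (x - y - 1))"
proof -
  define g where "g n = Gamma (real n + x) / Gamma (real n + y) * real n powr (y - x)" for n
  have g: "g \<longlonglongrightarrow> 1"
    unfolding g_def by (rule Gamma_ratio_tendsto[OF assms])
  define q where "q n = (real n + x) / (real n + y) * (real (Suc n) / real n) powr (y - x) - 1" for n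
  have "eventually (\<lambda>n. g (Suc n) - g n = g n * q n) sequentially"
    using eventually_gt_at_top[of 0]
  proof eventually_elim
    case (elim n)
    have "real (Suc n) powr (y - x) = (real (Suc n) / real n) powr (y - x) * real n powr (y - x)"
      using elim by (simp add: powr_divide)
    then show ?case
      unfolding g_def q_def Gamma_shift_Suc[OF assms(1)] Gamma_shift_Suc[OF assms(2)]
      by (simp add: right_diff_distrib mult_ac)
  qed
  then have "(\<lambda>n. g (Suc n) - g n) \<in> \<Theta>(\<lambda>n. g n * q n)"
    by (rule bigthetaI_cong)
  also have "(\<lambda>n. g n * q n) \<in> O(\<lambda>n. 1 * real n powr (-2))"
  proof (rule landau_o.big_mult)
    show "g \<in> O(\<lambda>_. 1)"
      by (rule bigoI_tendsto[where c = 1]) (use g in auto)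
    show "q \<in> O(\<lambda>n. real n powr (-2))"
      unfolding q_def by real_asymp
  qed
  finally have "(\<lambda>n. g n - 1) \<in> O(\<lambda>n. real n powr (1 - 2))"
    by (intro bigo_of_increments[OF g]) auto
  then have "(\<lambda>n. real n powr (x - y) * (g n - 1)) \<in> O(\<lambda>n. real n powr (x - y) * real n powr (1 - 2))"
    by (intro landau_o.big_mult) auto
  moreover have "real n powr (x - y) * real n powr (1 - 2) = real n powr (x - y - 1)" for n
    unfolding powr_add[symmetric] by simp
  ultimately have "(\<lambda>n. real n powr (x - y) * (g n - 1)) \<in> O(\<lambda>n. real n powr (x - y - 1))"
    by (simp only:)
  then show ?thesis
  proof (rule landau_o.big.in_cong[THEN iffD1, rotated])
    show "eventually (\<lambda>n. real n powr (x - y) * (g n - 1) = Gamma (real n + x) / Gamma (real n + y) - real n powr (x - y)) sequentially"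
      using eventually_gt_at_top[of 0]
    proof eventually_elim
      case (elim n)
      then have "real n powr (x - y) * real n powr (y - x) = 1"
        by (simp add: powr_add[symmetric])
      then have "real n powr (x - y) * (r * real n powr (y - x)) = r" for r
        by (simp add: mult.left_commute[of _ r])
      then show ?case
        by (simp add: g_def right_diff_distrib)
    qed
  qed
qed

section \<open>Partial sums of the zeta series\<close>

text \<open>
  The terms compare \<open>k\<^sup>-\<^sup>w\<close> with the integral of \<open>x\<^sup>-\<^sup>w\<close> over \<open>[k - 1, k]\<close>; the
  difference is of order \<open>k\<^sup>-\<^sup>w\<^sup>-\<^sup>1\<close>, so their sum converges for all \<open>w\<close> of positive real part.
\<close>

definition zeta_term :: "nat \<Rightarrow> complex \<Rightarrow> complex" where
  "zeta_term k w = of_nat (Suc (Suc k)) powr (-w)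
     - (of_nat (Suc (Suc k)) powr (1 - w) - of_nat (Suc k) powr (1 - w)) / (1 - w)"

text \<open>The leading \<open>1\<close> is the first summand of the Dirichlet series;
  \<open>- 1 / (1 - w)\<close> comes from the antiderivative of \<open>x powr (-w)\<close> at the
  lower end \<open>x = 1\<close>.\<close>

definition zeta_cont :: "complex \<Rightarrow> complex" where
  "zeta_cont w = 1 - 1 / (1 - w) + (\<Sum>k. zeta_term k w)"

text \<open>The mean value inequality is used twice: for the variation of \<open>z powr (-w)\<close>
  over the interval, and for a function whose derivative is that variation. The interval is taken as
  a complex segment, which avoids the branch cut of \<open>powr\<close>.\<close>

lemma zeta_term_bound:
  assumes re: "Re w > 0" and "w \<noteq> 1"
  shows "norm (zeta_term k w) \<le> norm w * real (Suc k) powr (- Re w - 1)"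
proof -
  define p q where "p = real (Suc k)" and "q = real (Suc (Suc k))"
  define I where "I = closed_segment (complex_of_real p) (complex_of_real q)"
  have pq: "p > 0" "p \<le> q" "q - p = 1"
    by (auto simp: p_def q_def)
  have I: "\<exists>x. z = of_real x \<and> p \<le> x \<and> x \<le> q" if "z \<in> I" for z
    using that pq by (auto simp: I_def closed_segment_of_real closed_segment_eq_real_ivl)
  have nonpos: "z \<notin> \<real>\<^sub>\<le>\<^sub>0" if "z \<in> I" for z
    using I[OF that] pq by auto
  have ends: "of_real p \<in> I" "of_real q \<in> I" "convex I"
    by (auto simp: I_def)
  let ?c = "norm w * p powr (- Re w - 1)"
  have diff: "norm (z powr (-w) - of_real q powr (-w)) \<le> ?c" if z: "z \<in> I" for z
  proof -
    have "norm (z powr (-w) - of_real q powr (-w)) \<le> ?c * norm (z - of_real q)"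
    proof (rule field_differentiable_bound[where f' = "\<lambda>z. -w * z powr (-w - 1)" and S = I])
      fix u assume u: "u \<in> I"
      show "((\<lambda>z. z powr (-w)) has_field_derivative -w * u powr (-w - 1)) (at u within I)"
        using nonpos[OF u] by (auto intro!: derivative_eq_intros)
      obtain x where x: "u = of_real x" "p \<le> x"
        using I[OF u] by blast
      have "norm (-w * u powr (-w - 1)) = norm w * x powr (- Re w - 1)"
        using x pq by (simp add: norm_mult norm_powr_real_powr)
      also have "\<dots> \<le> ?c"
        using x pq re by (intro mult_left_mono powr_mono2') auto
      finally show "norm (-w * u powr (-w - 1)) \<le> ?c" .
    qed (use ends z in auto)
    also have "\<dots> \<le> ?c * 1"
    proof (rule mult_left_mono)
      obtain x where "z = of_real x" "p \<le> x" "x \<le> q"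
        using I[OF z] by blast
      then have "norm (z - of_real q) = \<bar>x - q\<bar>" "\<bar>x - q\<bar> \<le> 1"
        using pq by (simp_all flip: of_real_diff)
      then show "norm (z - of_real q) \<le> 1"
        by simp
    qed auto
    finally show ?thesis
      by simp
  qed
  \<comment> \<open>The derivative of \<open>\<phi>\<close> is the variation already bounded by
    \<open>?c\<close>, and its increment over the segment is \<open>- zeta_term k w\<close>.\<close>
  define \<phi> where "\<phi> z = z powr (1 - w) / (1 - w) - z * of_real q powr (-w)" for z :: complex
  have "norm (\<phi> (of_real q) - \<phi> (of_real p)) \<le> ?c * norm (complex_of_real q - of_real p)"
  proof (rule field_differentiable_bound[where f' = "\<lambda>z. z powr (-w) - of_real q powr (-w)" and S = I])
    fix u assume u: "u \<in> I"
    show "(\<phi> has_field_derivative u powr (-w) - of_real q powr (-w)) (at u within I)"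
      unfolding \<phi>_def using nonpos[OF u] assms by (auto intro!: derivative_eq_intros)
    show "norm (u powr (-w) - of_real q powr (-w)) \<le> ?c"
      by (rule diff[OF u])
  qed (use ends in auto)
  also have "norm (complex_of_real q - of_real p) = 1"
    using pq by (simp flip: of_real_diff)
  also have "\<phi> (of_real q) - \<phi> (of_real p) = - zeta_term k w"
  proof -
    have "\<phi> (of_real q) - \<phi> (of_real p)
      = (of_real q powr (1 - w) - of_real p powr (1 - w)) / (1 - w) - of_real (q - p) * of_real q powr (-w)"
      unfolding \<phi>_def by (simp add: diff_divide_distrib algebra_simps)
    then show ?thesis
      unfolding pq by (simp add: zeta_term_def p_def q_def)
  qed
  finally show ?thesis
    by (simp add: p_def)
qed

lemma zeta_term_sums:
  assumes "Re w > 0" "w \<noteq> 1"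
  shows "(\<lambda>k. zeta_term k w) sums (zeta_cont w - (1 - 1 / (1 - w)))"
proof -
  have "summable (\<lambda>k. norm w * real (Suc k) powr (- Re w - 1))"
    using assms by (intro summable_mult) (subst summable_Suc_iff, simp add: summable_real_powr_iff)
  then have "summable (\<lambda>k. zeta_term k w)"
    by (rule summable_comparison_test') (rule zeta_term_bound[OF assms])
  then show ?thesis
    by (simp add: zeta_cont_def summable_sums)
qed

lemma zeta_partial_sum_eq:
  "(\<Sum>k<Suc n. of_nat (Suc k) powr (-w)) - of_nat (Suc n) powr (1 - w) / (1 - w)
    = 1 - 1 / (1 - w) + (\<Sum>k<n. zeta_term k w)" for w :: complex
proof (induction n)
  case (Suc n)
  then show ?case
    by (simp add: zeta_term_def diff_divide_distrib algebra_simps del: of_nat_Suc)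
qed simp

lemma zeta_cont_limit:
  assumes "Re w > 0" "w \<noteq> 1"
  shows "(\<lambda>n. (\<Sum>k<n. of_nat (Suc k) powr (-w)) - of_nat n powr (1 - w) / (1 - w)) \<longlonglongrightarrow> zeta_cont w"
proof (rule LIMSEQ_imp_Suc)
  have "(\<lambda>n. 1 - 1 / (1 - w) + (\<Sum>k<n. zeta_term k w)) \<longlonglongrightarrow> 1 - 1 / (1 - w) + (zeta_cont w - (1 - 1 / (1 - w)))"
    using zeta_term_sums[OF assms] unfolding sums_def by (intro tendsto_intros)
  then show "(\<lambda>n. (\<Sum>k<Suc n. of_nat (Suc k) powr (-w)) - of_nat (Suc n) powr (1 - w) / (1 - w)) \<longlonglongrightarrow> zeta_cont w"
    unfolding zeta_partial_sum_eq by simp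
qed

text \<open>To the right of 1 the correction \<open>n powr (1 - w) / (1 - w)\<close> tends to 0, so
  the corrected partial sums and the plain ones have the same limit.\<close>

lemma zeta_cont_sums:
  assumes "Re w > 1"
  shows "(\<lambda>n. 1 / of_nat (Suc n) powr w) sums zeta_cont w"
proof -
  have "(\<lambda>n. of_nat n powr (1 - w) / (1 - w)) \<longlonglongrightarrow> 0 / (1 - w)"
  proof (intro tendsto_divide tendsto_const)
    have "(\<lambda>n. real n powr (1 - Re w)) \<longlonglongrightarrow> 0"
      using assms by (intro tendsto_neg_powr filterlim_real_sequentially) auto
    moreover have "norm (of_nat n powr (1 - w)) = real n powr (1 - Re w)" for n
      using norm_powr_real_powr[of "of_nat n" "1 - w"] by simp
    ultimately show "(\<lambda>n. of_nat n powr (1 - w)) \<longlonglongrightarrow> 0"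
      by (subst tendsto_norm_zero_iff[symmetric]) simp
  qed (use assms in auto)
  then have "(\<lambda>n. ((\<Sum>k<n. of_nat (Suc k) powr (-w)) - of_nat n powr (1 - w) / (1 - w)) + of_nat n powr (1 - w) / (1 - w))
      \<longlonglongrightarrow> zeta_cont w + 0 / (1 - w)"
    using assms by (intro tendsto_add zeta_cont_limit) auto
  then show ?thesis
    by (simp add: sums_def powr_minus_divide del: of_nat_Suc)
qed

lemma zeta_cont_holomorphic: "zeta_cont holomorphic_on ({w. 0 < Re w} - {1})"
proof -
  have "(\<lambda>w. \<Sum>k. zeta_term k w) holomorphic_on ({w. 0 < Re w} - {1})"
  proof (rule holomorphic_uniform_sequence[where f = "\<lambda>n w. \<Sum>k<n. zeta_term k w"])
    show op: "open ({w. 0 < Re w} - {1})"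
      by (intro open_Diff open_halfspace_Re_gt) auto
    show "(\<lambda>w. \<Sum>k<n. zeta_term k w) holomorphic_on ({w. 0 < Re w} - {1})" for n
      unfolding zeta_term_def by (intro holomorphic_intros) auto
    fix w :: complex assume w: "w \<in> {w. 0 < Re w} - {1}"
    obtain e where e: "e > 0" "cball w e \<subseteq> {w. 0 < Re w} - {1}"
      using op w by (meson open_contains_cball)
    \<comment> \<open>The radius \<open>Re w / 2\<close> keeps all real parts on the ball at least
      \<open>Re w / 2\<close>, so that a single summable majorant serves the whole ball.\<close>
    define r where "r = min e (Re w / 2)"
    have r: "r > 0" "r \<le> e" "r \<le> Re w / 2"
      using e w by (auto simp: r_def)
    have sub: "cball w r \<subseteq> {w. 0 < Re w} - {1}"
      using e(2) r(2) by (meson order_trans subset_cball)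
    have "uniform_limit (cball w r) (\<lambda>n w. \<Sum>k<n. zeta_term k w) (\<lambda>w. \<Sum>k. zeta_term k w) sequentially"
    proof (rule Weierstrass_m_test)
      fix k z assume z: "z \<in> cball w r"
      then have z': "Re z > 0" "z \<noteq> 1"
        using sub by auto
      have "norm (w - z) \<le> r"
        using z by (simp add: dist_norm)
      then have "\<bar>Re (w - z)\<bar> \<le> r" "norm z \<le> norm w + r"
        using abs_Re_le_cmod[of "w - z"] norm_triangle_ineq3[of z w] by (auto simp: norm_minus_commute)
      then have "Re w / 2 \<le> Re z"
        using r(3) by auto
      have "norm (zeta_term k z) \<le> norm z * real (Suc k) powr (- Re z - 1)"
        by (rule zeta_term_bound[OF z'])
      also have "\<dots> \<le> (norm w + r) * real (Suc k) powr (- (Re w / 2) - 1)"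
        using \<open>norm z \<le> norm w + r\<close> \<open>Re w / 2 \<le> Re z\<close> r
        by (intro mult_mono powr_mono) auto
      finally show "norm (zeta_term k z) \<le> (norm w + r) * real (Suc k) powr (- (Re w / 2) - 1)" .
    next
      show "summable (\<lambda>k. (norm w + r) * real (Suc k) powr (- (Re w / 2) - 1))"
        using w by (intro summable_mult) (subst summable_Suc_iff, simp add: summable_real_powr_iff)
    qed
    then show "\<exists>d>0. cball w d \<subseteq> {w. 0 < Re w} - {1} \<and>
        uniform_limit (cball w d) (\<lambda>n w. \<Sum>k<n. zeta_term k w) (\<lambda>w. \<Sum>k. zeta_term k w) sequentially"
      using r sub by (intro exI[of _ r]) simp
  qed
  then show ?thesis
    unfolding zeta_cont_def by (intro holomorphic_intros) auto
qed

text \<open>Uniqueness is the identity theorem: any admissible \<open>f\<close> agrees with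
  \<open>zeta_cont\<close> on a half-plane to the right of 1, and the punctured half-plane common to
  both domains is connected.\<close>

lemma zeta_eq_zeta_cont:
  assumes "Re s > 0" "s \<noteq> 1"
  shows "zeta s = zeta_cont s"
  unfolding zeta_def
proof (rule the_equality)
  show "\<exists>c f. c < Re s \<and> f holomorphic_on ({w. c < Re w} - {1}) \<and>
     (\<forall>w. Re w > 1 \<longrightarrow> (\<lambda>n. 1 / of_nat (Suc n) powr w) sums f w) \<and> zeta_cont s = f s"
    using assms zeta_cont_holomorphic zeta_cont_sums by blast
next
  fix z assume "\<exists>c f. c < Re s \<and> f holomorphic_on ({w. c < Re w} - {1}) \<and>
     (\<forall>w. Re w > 1 \<longrightarrow> (\<lambda>n. 1 / of_nat (Suc n) powr w) sums f w) \<and> z = f s"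
  then obtain c f where c: "c < Re s" and hol: "f holomorphic_on ({w. c < Re w} - {1})"
    and sums: "\<And>w. Re w > 1 \<Longrightarrow> (\<lambda>n. 1 / of_nat (Suc n) powr w) sums f w" and z: "z = f s"
    by blast
  \<comment> \<open>Both functions are holomorphic to the right of \<open>c'\<close>, apart from 1.
    As \<open>c\<close> may itself exceed 1, the half-plane of agreement below starts at
    \<open>max 1 c'\<close>.\<close>
  define c' where "c' = max 0 c"
  have "f s = zeta_cont s"
  proof (rule analytic_continuation_open[where f = f and g = zeta_cont])
    show "open {w. Re w > max 1 c'}" "open ({w. Re w > c'} - {1})"
      by (intro open_Diff open_halfspace_Re_gt; auto)+
    show "connected ({w. Re w > c'} - {1})"
      by (intro connected_open_delete open_halfspace_Re_gt convex_connected convex_halfspace_Re_gt) auto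
    have "of_real (max 1 c' + 1) \<in> {w. Re w > max 1 c'}"
      by (simp only: mem_Collect_eq Re_complex_of_real less_add_one)
    then show "{w. Re w > max 1 c'} \<noteq> {}"
      by blast
    show "{w. Re w > max 1 c'} \<subseteq> {w. Re w > c'} - {1}"
      by auto
    show "f holomorphic_on ({w. Re w > c'} - {1})" "zeta_cont holomorphic_on ({w. Re w > c'} - {1})"
      by (rule holomorphic_on_subset[OF hol] holomorphic_on_subset[OF zeta_cont_holomorphic]; auto simp: c'_def)+
    show "f w = zeta_cont w" if "w \<in> {w. Re w > max 1 c'}" for w
      using that sums zeta_cont_sums sums_unique2 by fastforce
    show "s \<in> {w. Re w > c'} - {1}"
      using c assms by (auto simp: c'_def)
  qed
  then show "z = zeta_cont s"
    using z by simp
qed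

text \<open>Also for \<open>s < 1\<close>, where the series diverges, the corrected partial sums
  converge: their increments are values of \<open>zeta_term\<close>, of order
  \<open>n powr (-s - 1)\<close>. The limit is the continued zeta value, and the rate follows from
  the increments.\<close>

lemma zeta_partial_sums:
  fixes s :: real
  assumes "0 < s" "s \<noteq> 1"
  shows "(\<lambda>n. (\<Sum>k<n. real (Suc k) powr (-s)) - real n powr (1 - s) / (1 - s) - Re (zeta (of_real s)))
    \<in> O(\<lambda>n. real n powr (-s))"
proof -
  define h where "h n = (\<Sum>k<n. real (Suc k) powr (-s)) - real n powr (1 - s) / (1 - s)" for n
  have powr_of_real: "of_nat n powr complex_of_real r = of_real (real n powr r)" for n r
    using powr_of_real[of "real n" r] by simp
  have real: "of_real (h n) = (\<Sum>k<n. of_nat (Suc k) powr (- complex_of_real s)) - of_nat n powr (1 - complex_of_real s) / (1 - complex_of_real s)" for n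
  proof -
    have "- complex_of_real s = of_real (- s)" "1 - complex_of_real s = of_real (1 - s)"
      by simp_all
    then show ?thesis
      unfolding h_def by (simp only: powr_of_real) simp
  qed
  have "(\<lambda>n. complex_of_real (h n)) \<longlonglongrightarrow> zeta (of_real s)"
    unfolding real using assms by (subst zeta_eq_zeta_cont; (intro zeta_cont_limit)?) auto
  then have lim: "h \<longlonglongrightarrow> Re (zeta (of_real s))"
    by (drule_tac tendsto_Re) simp
  have "eventually (\<lambda>n. norm (h (Suc n) - h n) \<le> s * norm (real n powr (- (s + 1)))) sequentially"
    using eventually_gt_at_top[of 0]
  proof eventually_elim
    case (elim n)
    then obtain k where n: "n = Suc k"
      by (cases n) auto
    have "of_real (h (Suc n) - h n) = zeta_term k (of_real s)"
      unfolding of_real_diff real n by (simp add: zeta_term_def diff_divide_distrib del: of_nat_Suc)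
    then have "norm (h (Suc n) - h n) = norm (zeta_term k (of_real s))"
      by (metis norm_of_real real_norm_def)
    also have "\<dots> \<le> s * real (Suc k) powr (- s - 1)"
      using zeta_term_bound[of "of_real s" k] assms by simp
    finally show ?case
      by (simp add: n)
  qed
  then have "(\<lambda>n. h (Suc n) - h n) \<in> O(\<lambda>n. real n powr (- (s + 1)))"
    by (rule bigoI)
  then have "(\<lambda>n. h n - Re (zeta (of_real s))) \<in> O(\<lambda>n. real n powr (1 - (s + 1)))"
    using assms by (intro bigo_of_increments[OF lim]) auto
  then show ?thesis
    by (simp add: h_def)
qed

section \<open>Linear recursions\<close>

lemma bigo_cmult: "f \<in> O[F](g) \<Longrightarrow> (\<lambda>x. c * f x) \<in> O[F](g)" for c :: real
  by (cases "c = 0") auto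

lemma const_bigo_powr: "(\<lambda>n. c) \<in> O(\<lambda>n. real n powr 0)" for c :: real
  by real_asymp

lemma bigo_powr_mult:
  fixes f g :: "nat \<Rightarrow> real"
  assumes "f \<in> O(\<lambda>n. real n powr p)" "g \<in> O(\<lambda>n. real n powr q)" "p + q = r"
  shows "(\<lambda>n. f n * g n) \<in> O(\<lambda>n. real n powr r)"
  using landau_o.big_mult[OF assms(1,2)] assms(3) by (simp flip: powr_add)

lemma powr_bigo_powr: "p \<le> q \<Longrightarrow> (\<lambda>n. real n powr p) \<in> O(\<lambda>n. real n powr q)"
  by (rule bigoI[of _ 1], rule eventually_mono[OF eventually_gt_at_top[of 0]]) (simp add: powr_mono)

lemma bigo_powr_mono:
  fixes f :: "nat \<Rightarrow> real"
  assumes "f \<in> O(\<lambda>n. real n powr p)" "p \<le> q"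
  shows "f \<in> O(\<lambda>n. real n powr q)"
  using assms(1) powr_bigo_powr[OF assms(2)] by (rule landau_o.big_trans)

lemma bigo_powr_Suc:
  fixes f :: "nat \<Rightarrow> real"
  assumes "f \<in> O(\<lambda>n. real n powr s)"
  shows "(\<lambda>n. f (Suc n)) \<in> O(\<lambda>n. real n powr s)"
proof -
  have "(\<lambda>n. f (Suc n)) \<in> O(\<lambda>n. real (Suc n) powr s)"
    by (rule landau_o.big.compose[OF assms filterlim_Suc])
  also have "(\<lambda>n. real (Suc n) powr s) \<in> O(\<lambda>n. real n powr s)"
    by real_asymp
  finally show ?thesis .
qed

lemma inverse_bigo_powr:
  fixes \<psi> :: "nat \<Rightarrow> real"
  assumes "(\<lambda>n. \<psi> n - real n powr s) \<in> O(\<lambda>n. real n powr (s - 1))"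
  shows "(\<lambda>n. inverse (\<psi> n)) \<in> O(\<lambda>n. real n powr (-s))"
proof (rule bigoI_tendsto)
  have "(\<lambda>n. (\<psi> n - real n powr s) * real n powr (-s)) \<in> O(\<lambda>n. real n powr (-1))"
    by (rule bigo_powr_mult[OF assms landau_o.big_refl]) simp
  also have "(\<lambda>n. real n powr (-1)) \<in> o(\<lambda>_. 1)"
    by real_asymp
  finally have "(\<lambda>n. (\<psi> n - real n powr s) * real n powr (-s)) \<longlonglongrightarrow> 0"
    by (rule smalloD_tendsto[where g = "\<lambda>_. 1", simplified])
  then have "(\<lambda>n. inverse (1 + (\<psi> n - real n powr s) * real n powr (-s))) \<longlonglongrightarrow> inverse (1 + 0)"
    by (intro tendsto_intros) auto
  then have "(\<lambda>n. inverse (1 + (\<psi> n - real n powr s) * real n powr (-s))) \<longlonglongrightarrow> 1"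
    by simp
  then show "(\<lambda>n. inverse (\<psi> n) / real n powr (-s)) \<longlonglongrightarrow> 1"
  proof (rule Lim_transform_eventually)
    show "eventually (\<lambda>n. inverse (1 + (\<psi> n - real n powr s) * real n powr (-s)) = inverse (\<psi> n) / real n powr (-s)) sequentially"
      using eventually_gt_at_top[of 0]
    proof eventually_elim
      case (elim n)
      then have "real n powr s * real n powr (-s) = 1"
        by (simp flip: powr_add)
      then have "1 + (\<psi> n - real n powr s) * real n powr (-s) = \<psi> n * real n powr (-s)"
        by (simp add: left_diff_distrib)
      then show ?case
        by (simp add: divide_inverse)
    qed
  qed
qed (auto intro!: eventually_mono[OF eventually_gt_at_top[of 0]])

text \<open>Variation of constants: after division by the homogeneous solution \<open>\<psi>\<close>
  the recursion becomes a plain summation.\<close>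

lemma linear_recursion_increment:
  fixes S \<alpha> g \<psi> :: "nat \<Rightarrow> real"
  assumes "S (Suc n) = \<alpha> n * S n + g n" "\<psi> (Suc n) = \<alpha> n * \<psi> n" "\<psi> (Suc n) \<noteq> 0"
  shows "S (Suc n) / \<psi> (Suc n) - S n / \<psi> n = g n * inverse (\<psi> (Suc n))"
proof -
  have "\<alpha> n \<noteq> 0" "\<psi> n \<noteq> 0"
    using assms(2,3) by auto
  then show ?thesis
    by (simp add: assms(1,2) field_simps)
qed

text \<open>Since \<open>\<alpha> n * n\<close> is close to \<open>n + l\<close>, the line with
  slope \<open>\<rho> / (1 - l)\<close> solves the recursion up to a vanishing error
  \<open>\<epsilon>\<close>. It remains to show that the deviation \<open>D\<close>, driven by
  \<open>\<epsilon>\<close> alone, is o(n). Factors \<open>\<alpha> n\<close> that are zero or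
  negative for early \<open>n\<close> do no harm, because nothing is divided by them.\<close>

lemma linear_recursion_subcritical:
  fixes V \<alpha> r :: "nat \<Rightarrow> real"
  assumes rec: "\<And>n. V (Suc n) = \<alpha> n * V n + r n"
    and \<alpha>: "(\<lambda>n. real n * (\<alpha> n - 1)) \<longlonglongrightarrow> l" and l: "l < 1"
    and r: "r \<longlonglongrightarrow> \<rho>"
  shows "(\<lambda>n. V n - \<rho> / (1 - l) * real n) \<in> o(\<lambda>n. real n)"
proof -
  define c where "c = \<rho> / (1 - l)"
  define D where "D n = V n - c * real n" for n
  define \<epsilon> where "\<epsilon> n = c * (real n * (\<alpha> n - 1)) + r n - c" for n
  have D_Suc: "D (Suc n) = \<alpha> n * D n + \<epsilon> n" for n
    by (simp add: D_def \<epsilon>_def rec algebra_simps)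
  have "\<epsilon> \<longlonglongrightarrow> c * l + \<rho> - c"
    unfolding \<epsilon>_def by (intro tendsto_intros \<alpha> r)
  also have "c * l + \<rho> - c = 0"
    using l by (simp add: c_def field_simps)
  finally have \<epsilon>: "\<epsilon> \<longlonglongrightarrow> 0" .
  \<comment> \<open>An intermediate exponent: \<open>\<eta> n + C n\<^sup>\<kappa>\<close> is eventually a supersolution of the recursion for \<open>D\<close>.\<close>
  define \<kappa> \<kappa>' where "\<kappa> = (1 + max l 0) / 2" and "\<kappa>' = (1 + \<kappa>) / 2"
  have \<kappa>: "l < \<kappa>" "0 < \<kappa>" "\<kappa> < 1" "\<kappa> < \<kappa>'" "\<kappa>' < 1"
    using l by (auto simp: \<kappa>_def \<kappa>'_def)
  define R where "R n = (real (Suc n) / real n) powr \<kappa>" for n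
  have R: "(\<lambda>n. real n * (R n - 1)) \<longlonglongrightarrow> \<kappa>"
    unfolding R_def by real_asymp
  have "(\<lambda>n. real n * (\<alpha> n - 1) * (1 / real n)) \<longlonglongrightarrow> l * 0"
    by (intro tendsto_mult \<alpha>) real_asymp
  then have "eventually (\<lambda>n. real n * (\<alpha> n - 1) * (1 / real n) > -1) sequentially"
    by (intro order_tendstoD) auto
  then have \<alpha>_pos: "eventually (\<lambda>n. \<alpha> n > 0) sequentially"
    using eventually_gt_at_top[of 0] by eventually_elim simp
  have \<alpha>_le: "eventually (\<lambda>n. \<bar>\<alpha> n\<bar> \<le> R n) sequentially"
  proof -
    have mid: "l < (l + \<kappa>) / 2" "(l + \<kappa>) / 2 < \<kappa>"
      using \<kappa> by auto
    show ?thesis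
      using order_tendstoD(2)[OF \<alpha> mid(1)] order_tendstoD(1)[OF R mid(2)]
        \<alpha>_pos eventually_gt_at_top[of 0]
    proof eventually_elim
      case (elim n)
      then have "real n * (\<alpha> n - 1) < real n * (R n - 1)"
        by linarith
      then show ?case
        using elim by simp
    qed
  qed
  have R_le: "eventually (\<lambda>n. real n * R n \<le> real n + \<kappa>') sequentially"
    using order_tendstoD(2)[OF R \<kappa>(4)] by eventually_elim (simp add: algebra_simps)
  show ?thesis
    unfolding c_def[symmetric] D_def[symmetric]
  proof (rule landau_o.smallI)
    fix e :: real assume e: "e > 0"
    define \<eta> where "\<eta> = e / 2"
    have \<eta>: "\<eta> > 0" "\<eta> * (1 - \<kappa>') > 0"
      using e \<kappa> by (auto simp: \<eta>_def)
    have "eventually (\<lambda>n. \<bar>\<epsilon> n\<bar> < \<eta> * (1 - \<kappa>')) sequentially"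
      using \<eta>(2) tendsto_rabs_zero[OF \<epsilon>] by (rule order_tendstoD(2)[rotated])
    then have "eventually (\<lambda>n. \<bar>\<epsilon> n\<bar> < \<eta> * (1 - \<kappa>') \<and> \<bar>\<alpha> n\<bar> \<le> R n \<and> real n * R n \<le> real n + \<kappa>' \<and> n > 0) sequentially"
      using \<alpha>_le R_le eventually_gt_at_top[of 0] by eventually_elim simp
    then obtain N where N: "\<And>n. n \<ge> N \<Longrightarrow> \<bar>\<epsilon> n\<bar> < \<eta> * (1 - \<kappa>')" "\<And>n. n \<ge> N \<Longrightarrow> \<bar>\<alpha> n\<bar> \<le> R n"
      "\<And>n. n \<ge> N \<Longrightarrow> real n * R n \<le> real n + \<kappa>'" "\<And>n. n \<ge> N \<Longrightarrow> n > 0"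
      unfolding eventually_sequentially by blast
    \<comment> \<open>Multiplication by \<open>R n\<close> raises \<open>\<eta> * n\<close> by at
      most \<open>\<eta> * \<kappa>'\<close> and turns \<open>n powr \<kappa>\<close> exactly into
      its successor; the remaining \<open>\<eta> * (1 - \<kappa>')\<close> of the next linear term
      absorbs \<open>\<epsilon> n\<close>.\<close>
    have bound: "\<bar>D n\<bar> \<le> \<eta> * real n + \<bar>D N\<bar> * real n powr \<kappa>" if "n \<ge> N" for n
      using that
    proof (induction n rule: dec_induct)
      case base
      have "1 \<le> real N powr \<kappa>"
        using N(4)[of N] \<kappa> by (intro ge_one_powr_ge_zero) auto
      then have "\<bar>D N\<bar> * 1 \<le> \<bar>D N\<bar> * real N powr \<kappa>"
        by (intro mult_left_mono) auto
      then show ?case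
        using \<eta>(1) by (simp add: add_increasing)
    next
      case (step n)
      have n: "n > 0"
        using N(4) step by simp
      have "\<bar>D (Suc n)\<bar> \<le> \<bar>\<alpha> n\<bar> * \<bar>D n\<bar> + \<bar>\<epsilon> n\<bar>"
        unfolding D_Suc abs_mult[symmetric] by (rule abs_triangle_ineq)
      also have "\<bar>\<alpha> n\<bar> * \<bar>D n\<bar> \<le> R n * (\<eta> * real n + \<bar>D N\<bar> * real n powr \<kappa>)"
        using N(2)[OF step(1)] step(3) by (intro mult_mono) (auto simp: R_def)
      also have "\<dots> = \<eta> * (real n * R n) + \<bar>D N\<bar> * (R n * real n powr \<kappa>)"
        by (simp add: algebra_simps)
      also have "R n * real n powr \<kappa> = real (Suc n) powr \<kappa>"
        using n by (simp add: R_def powr_divide)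
      also have "\<eta> * (real n * R n) \<le> \<eta> * (real n + \<kappa>')"
        using \<eta>(1) N(3)[OF step(1)] by (intro mult_left_mono) auto
      finally show ?case
        using N(1)[OF step(1)] by (simp add: algebra_simps)
    qed
    have "(\<lambda>n. \<bar>D N\<bar> * real n powr (\<kappa> - 1)) \<longlonglongrightarrow> \<bar>D N\<bar> * 0"
      using \<kappa> by (intro tendsto_mult tendsto_const tendsto_neg_powr filterlim_real_sequentially) auto
    then have "eventually (\<lambda>n. \<bar>D N\<bar> * real n powr (\<kappa> - 1) < \<eta>) sequentially"
      using \<eta>(1) by (intro order_tendstoD(2)) auto
    then show "eventually (\<lambda>n. norm (D n) \<le> e * norm (real n)) sequentially"
      using eventually_ge_at_top[of N] eventually_gt_at_top[of 0]
    proof eventually_elim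
      case (elim n)
      have "real n powr \<kappa> = real n powr (\<kappa> - 1) * real n"
        using elim powr_add[of "real n" "\<kappa> - 1" 1] by simp
      then have "\<bar>D N\<bar> * real n powr \<kappa> = \<bar>D N\<bar> * real n powr (\<kappa> - 1) * real n"
        by simp
      also have "\<dots> \<le> \<eta> * real n"
        using elim by (intro mult_right_mono) auto
      finally show ?case
        using bound[OF elim(2)] by (simp add: \<eta>_def)
    qed
  qed
qed

text \<open>The quotient of \<open>V\<close> by \<open>\<psi>\<close> has increments
  \<open>\<rho> / (n + 1)\<close> up to order n^(-3/2), so removing \<open>\<rho> * ln n\<close>
  leaves a convergent, hence bounded, sequence \<open>q\<close>. Multiplying back by
  \<open>\<psi>\<close>, which is n + O(1), costs O(n) for \<open>q\<close> and O(log n) for the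
  logarithm.\<close>

lemma linear_recursion_critical:
  fixes V \<alpha> r \<psi> :: "nat \<Rightarrow> real"
  assumes rec: "\<And>n. V (Suc n) = \<alpha> n * V n + r n"
    and \<psi>_Suc: "\<And>n. \<psi> (Suc n) = \<alpha> n * \<psi> n" and \<psi>_nz: "\<And>n. \<psi> n \<noteq> 0"
    and \<psi>: "(\<lambda>n. \<psi> n - real n powr 1) \<in> O(\<lambda>n. real n powr 0)"
    and r: "(\<lambda>n. r n - \<rho>) \<in> O(\<lambda>n. real n powr (-1/2))"
  shows "(\<lambda>n. V n - \<rho> * (real n * ln (real n))) \<in> O(\<lambda>n. real n)"
proof -
  define q where "q n = V n / \<psi> n - \<rho> * ln (real n)" for n
  have inv: "(\<lambda>n. inverse (\<psi> n)) \<in> O(\<lambda>n. real n powr (-1))"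
    by (rule inverse_bigo_powr) (use \<psi> in simp)
  \<comment> \<open>The three summands are the error of \<open>r\<close> against
    \<open>\<rho>\<close>, of \<open>\<psi>\<close> against the identity, and of
    \<open>1 / (n + 1)\<close> against the increment of the logarithm.\<close>
  have incr_eq: "q (Suc n) - q n = (r n - \<rho>) * inverse (\<psi> (Suc n))
      - \<rho> * ((\<psi> (Suc n) - real (Suc n) powr 1) * (inverse (\<psi> (Suc n)) * inverse (real (Suc n))))
      + \<rho> * (inverse (real (Suc n)) - (ln (real (Suc n)) - ln (real n)))" for n
  proof -
    have "V (Suc n) / \<psi> (Suc n) - V n / \<psi> n = r n * inverse (\<psi> (Suc n))"
      by (rule linear_recursion_increment[of V n \<alpha> r \<psi>, OF rec \<psi>_Suc \<psi>_nz])
    moreover have "(\<psi> (Suc n) - real (Suc n) powr 1) * (inverse (\<psi> (Suc n)) * inverse (real (Suc n)))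
      = inverse (real (Suc n)) - inverse (\<psi> (Suc n))"
      using \<psi>_nz[of "Suc n"] by (simp add: left_diff_distrib mult.assoc[symmetric] del: of_nat_Suc)
    ultimately show ?thesis
      by (simp only: q_def) (simp add: algebra_simps del: of_nat_Suc)
  qed
  have "(\<lambda>n. q (Suc n) - q n) \<in> O(\<lambda>n. real n powr (-(3/2)))"
    unfolding incr_eq
  proof (intro sum_in_bigo)
    show "(\<lambda>n. (r n - \<rho>) * inverse (\<psi> (Suc n))) \<in> O(\<lambda>n. real n powr (-(3/2)))"
      by (rule bigo_powr_mult[OF r bigo_powr_Suc[OF inv]]) simp
    have "(\<lambda>n. inverse (real (Suc n))) \<in> O(\<lambda>n. real n powr (-1))"
      by real_asymp
    then have "(\<lambda>n. (\<psi> (Suc n) - real (Suc n) powr 1) * (inverse (\<psi> (Suc n)) * inverse (real (Suc n)))) \<in> O(\<lambda>n. real n powr (-2))"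
      by (rule bigo_powr_mult[OF bigo_powr_Suc[OF \<psi>] bigo_powr_mult[OF bigo_powr_Suc[OF inv]]])
        (rule refl, simp)
    then have "(\<lambda>n. (\<psi> (Suc n) - real (Suc n) powr 1) * (inverse (\<psi> (Suc n)) * inverse (real (Suc n)))) \<in> O(\<lambda>n. real n powr (-(3/2)))"
      by (rule bigo_powr_mono) simp
    then show "(\<lambda>n. \<rho> * ((\<psi> (Suc n) - real (Suc n) powr 1) * (inverse (\<psi> (Suc n)) * inverse (real (Suc n))))) \<in> O(\<lambda>n. real n powr (-(3/2)))"
      by (cases "\<rho> = 0") auto
    have "(\<lambda>n. inverse (real (Suc n)) - (ln (real (Suc n)) - ln (real n))) \<in> O(\<lambda>n. real n powr (-(3/2)))"
      by real_asymp
    then show "(\<lambda>n. \<rho> * (inverse (real (Suc n)) - (ln (real (Suc n)) - ln (real n)))) \<in> O(\<lambda>n. real n powr (-(3/2)))"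
      by (cases "\<rho> = 0") auto
  qed
  then have "convergent q"
    by (rule convergent_of_increments[rotated]) simp
  then obtain L where "q \<longlonglongrightarrow> L"
    by (auto simp: convergent_def)
  then have q: "q \<in> O(\<lambda>_. 1)"
    by (intro bigoI_tendsto[where c = L]) auto
  have "\<psi> \<in> O(\<lambda>n. real n)"
  proof -
    have "(\<lambda>n. (\<psi> n - real n powr 1) + real n) \<in> O(\<lambda>n. real n)"
      by (rule sum_in_bigo(1)) (use bigo_powr_mono[OF \<psi>, of 1] in simp_all)
    then show ?thesis
      by (simp only: powr_one of_nat_0_le_iff diff_add_cancel)
  qed
  then have "(\<lambda>n. \<psi> n * q n) \<in> O(\<lambda>n. real n * 1)"
    using q by (rule landau_o.big_mult)
  moreover have "(\<lambda>n. \<rho> * ((\<psi> n - real n powr 1) * ln (real n))) \<in> O(\<lambda>n. real n)"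
  proof -
    have "(\<lambda>n. (\<psi> n - real n powr 1) * ln (real n)) \<in> O(\<lambda>n. real n powr 0 * ln (real n))"
      by (intro landau_o.big_mult \<psi>) auto
    also have "(\<lambda>n. real n powr 0 * ln (real n)) \<in> O(\<lambda>n. real n)"
      by real_asymp
    finally show ?thesis
      by (cases "\<rho> = 0") auto
  qed
  ultimately have "(\<lambda>n. \<psi> n * q n + \<rho> * ((\<psi> n - real n powr 1) * ln (real n))) \<in> O(\<lambda>n. real n)"
    by (intro sum_in_bigo) auto
  also have "(\<lambda>n. \<psi> n * q n + \<rho> * ((\<psi> n - real n powr 1) * ln (real n))) = (\<lambda>n. V n - \<rho> * (real n * ln (real n)))"
    using \<psi>_nz by (auto simp: q_def right_diff_distrib left_diff_distrib mult_ac)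
  finally show ?thesis .
qed

text \<open>\<open>L\<close> is the increment of the quotient of \<open>S\<close> by
  \<open>\<psi>\<close> minus its explicit non-summable part. The summand \<open>- K^2\<close> of
  the constant comes from the square of \<open>K * n powr \<Lambda>\<close> in the mean.\<close>

lemma linear_recursion_supercritical:
  fixes S M \<alpha> \<beta> \<psi> :: "nat \<Rightarrow> real" and a K \<Lambda> :: real
  defines "A \<equiv> a / (1 - \<Lambda>)"
  defines "L \<equiv> (\<lambda>j. (\<beta> j * M (j - 1) + a\<^sup>2
      - 2 * a * \<psi> j * real j powr (-\<Lambda>) * (A * real j powr (1 - \<Lambda>) + K)) / \<psi> j)"
  assumes \<Lambda>: "1/2 < \<Lambda>" "\<Lambda> < 1"
    and S_Suc: "\<And>n. S (Suc n) = \<alpha> n * S n + (\<beta> (Suc n) * M n + a\<^sup>2)"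
    and \<psi>_Suc: "\<And>n. \<psi> (Suc n) = \<alpha> n * \<psi> n" and \<psi>_nz: "\<And>n. \<psi> n \<noteq> 0"
    and \<psi>: "(\<lambda>n. \<psi> n - real n powr (2 * \<Lambda>)) \<in> O(\<lambda>n. real n powr (2 * \<Lambda> - 1))"
    and \<beta>: "(\<lambda>n. \<beta> (Suc n) - 2 * a) \<in> O(\<lambda>n. real n powr (-1))"
    and M: "(\<lambda>n. M n - (A * real n + K * real n powr \<Lambda>)) \<in> O(\<lambda>n. real n powr 0)"
  shows "summable (\<lambda>j. L (Suc j))"
    and "(\<lambda>n. S n - (M n)\<^sup>2
        - (S 0 / \<psi> 0 + (\<Sum>j. L (Suc j)) + 2 * a\<^sup>2 / (1 - \<Lambda>) * Re (zeta (of_real (2 * \<Lambda> - 1)))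
           + 2 * a * K * Re (zeta (of_real \<Lambda>)) - K\<^sup>2) * real n powr (2 * \<Lambda>)) \<in> O(\<lambda>n. real n)"
proof -
  define M\<^sub>0 where "M\<^sub>0 n = A * real n + K * real n powr \<Lambda>" for n :: nat
  have M\<^sub>0_bigo: "M\<^sub>0 \<in> O(\<lambda>n. real n powr 1)"
  proof -
    have "(\<lambda>n. A * real n) \<in> O(\<lambda>n. real n powr 1)" "(\<lambda>n. K * real n powr \<Lambda>) \<in> O(\<lambda>n. real n powr 1)"
      using \<Lambda> by (auto intro!: powr_bigo_powr[of \<Lambda> 1, simplified] landau_o.big.cmult_in_iff[THEN iffD2])
    then show ?thesis
      unfolding M\<^sub>0_def by (rule sum_in_bigo(1))
  qed
  have M_bigo: "M \<in> O(\<lambda>n. real n powr 1)"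
  proof -
    have "(\<lambda>n. M n - M\<^sub>0 n) \<in> O(\<lambda>n. real n powr 1)"
      unfolding M\<^sub>0_def by (rule bigo_powr_mono[OF M]) simp
    then have "(\<lambda>n. (M n - M\<^sub>0 n) + M\<^sub>0 n) \<in> O(\<lambda>n. real n powr 1)"
      using M\<^sub>0_bigo by (rule sum_in_bigo(1))
    then show ?thesis
      by (simp only: diff_add_cancel)
  qed
  \<comment> \<open>For positive \<open>n\<close> this is
    \<open>M\<^sub>0 n / n powr (2 * \<Lambda>)\<close>, and \<open>2 * a * z\<close> is the part
    split off from the increments; both exponents exceed -1 because
    \<open>\<Lambda> < 1\<close>.\<close>
  define z where "z n = A * real n powr (1 - 2 * \<Lambda>) + K * real n powr (-\<Lambda>)" for n :: nat
  have z_bigo: "z \<in> O(\<lambda>n. real n powr (1 - 2 * \<Lambda>))"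
  proof -
    have "(\<lambda>n. A * real n powr (1 - 2 * \<Lambda>)) \<in> O(\<lambda>n. real n powr (1 - 2 * \<Lambda>))"
      "(\<lambda>n. K * real n powr (-\<Lambda>)) \<in> O(\<lambda>n. real n powr (1 - 2 * \<Lambda>))"
      using \<Lambda> by (auto intro!: powr_bigo_powr simp: landau_o.big.cmult_in_iff')
    then show ?thesis
      unfolding z_def by (rule sum_in_bigo(1))
  qed
  have powr_mult_z: "real (Suc n) powr (2 * \<Lambda>) * z (Suc n) = M\<^sub>0 (Suc n)"
    and z_eq: "real (Suc n) powr (-\<Lambda>) * (A * real (Suc n) powr (1 - \<Lambda>) + K) = z (Suc n)" for n
  proof -
    have "x powr (2 * \<Lambda>) * (A * x powr (1 - 2 * \<Lambda>) + K * x powr (-\<Lambda>)) = A * x + K * x powr \<Lambda>"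
      "x powr (-\<Lambda>) * (A * x powr (1 - \<Lambda>) + K) = A * x powr (1 - 2 * \<Lambda>) + K * x powr (-\<Lambda>)" if "x > 0" for x
      using that by (simp_all add: distrib_left mult.left_commute flip: powr_add)
    then show "real (Suc n) powr (2 * \<Lambda>) * z (Suc n) = M\<^sub>0 (Suc n)"
      "real (Suc n) powr (-\<Lambda>) * (A * real (Suc n) powr (1 - \<Lambda>) + K) = z (Suc n)"
      by (simp_all add: z_def M\<^sub>0_def del: of_nat_Suc)
  qed
  define g where "g n = \<beta> (Suc n) * M n + a\<^sup>2" for n
  have L_eq: "L (Suc n) = g n * inverse (\<psi> (Suc n)) - 2 * a * z (Suc n)" for n
    unfolding L_def g_def mult.assoc z_eq using \<psi>_nz[of "Suc n"]
    by (simp add: field_simps del: of_nat_Suc)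
  \<comment> \<open>Over the denominator \<open>\<psi> (Suc n)\<close> the numerator splits into
    five terms of order 1: each loss of accuracy in \<open>\<beta>\<close>, \<open>M\<close>, the
    index shift or \<open>\<psi>\<close> is compensated by the size of its cofactor. Summability
    then follows from \<open>2 * \<Lambda> > 1\<close>.\<close>
  have L_eq': "L (Suc n) = ((\<beta> (Suc n) - 2 * a) * M n + 2 * a * (M n - M\<^sub>0 n) + 2 * a * (M\<^sub>0 n - M\<^sub>0 (Suc n)) + a\<^sup>2
      - 2 * a * ((\<psi> (Suc n) - real (Suc n) powr (2 * \<Lambda>)) * z (Suc n))) * inverse (\<psi> (Suc n))" for n
  proof -
    have "z (Suc n) = \<psi> (Suc n) * z (Suc n) * inverse (\<psi> (Suc n))"
      using \<psi>_nz[of "Suc n"] by simp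
    then have "L (Suc n) = (g n - 2 * a * (\<psi> (Suc n) * z (Suc n))) * inverse (\<psi> (Suc n))"
      unfolding L_eq by (simp add: left_diff_distrib mult.assoc)
    also have "\<psi> (Suc n) * z (Suc n) = (\<psi> (Suc n) - real (Suc n) powr (2 * \<Lambda>)) * z (Suc n) + M\<^sub>0 (Suc n)"
      by (simp only: left_diff_distrib powr_mult_z)
    finally show ?thesis
      by (simp add: g_def algebra_simps)
  qed
  have L_bigo: "(\<lambda>n. L (Suc n)) \<in> O(\<lambda>n. real n powr (- (2 * \<Lambda>)))"
    unfolding L_eq'
  proof (rule bigo_powr_mult[of _ 0])
    show "(\<lambda>n. inverse (\<psi> (Suc n))) \<in> O(\<lambda>n. real n powr (- (2 * \<Lambda>)))"
      by (rule bigo_powr_Suc[OF inverse_bigo_powr[OF \<psi>]])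
    have *: "(\<lambda>n. 2 * a * f n) \<in> O(\<lambda>n. real n powr 0)" if "f \<in> O(\<lambda>n. real n powr 0)" for f :: "nat \<Rightarrow> real"
      using that by (cases "a = 0") auto
    show "(\<lambda>n. (\<beta> (Suc n) - 2 * a) * M n + 2 * a * (M n - M\<^sub>0 n) + 2 * a * (M\<^sub>0 n - M\<^sub>0 (Suc n)) + a\<^sup>2
        - 2 * a * ((\<psi> (Suc n) - real (Suc n) powr (2 * \<Lambda>)) * z (Suc n))) \<in> O(\<lambda>n. real n powr 0)"
    proof (rule sum_in_bigo(2)[OF sum_in_bigo(1)[OF sum_in_bigo(1)[OF sum_in_bigo(1)]]])
      show "(\<lambda>n. (\<beta> (Suc n) - 2 * a) * M n) \<in> O(\<lambda>n. real n powr 0)"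
        by (rule bigo_powr_mult[OF \<beta> M_bigo]) simp
      show "(\<lambda>n. 2 * a * (M n - M\<^sub>0 n)) \<in> O(\<lambda>n. real n powr 0)"
        unfolding M\<^sub>0_def by (rule *[OF M])
      show "(\<lambda>n. 2 * a * (M\<^sub>0 n - M\<^sub>0 (Suc n))) \<in> O(\<lambda>n. real n powr 0)"
      proof (rule *)
        have "(\<lambda>n. real n powr \<Lambda> - real (Suc n) powr \<Lambda>) \<in> O(\<lambda>n. real n powr 0)"
          using \<Lambda> by real_asymp
        then have "(\<lambda>n. K * (real n powr \<Lambda> - real (Suc n) powr \<Lambda>)) \<in> O(\<lambda>n. real n powr 0)"
          by (cases "K = 0") auto
        moreover have "(\<lambda>n. A) \<in> O(\<lambda>n. real n powr 0)"
          by real_asymp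
        ultimately have "(\<lambda>n. K * (real n powr \<Lambda> - real (Suc n) powr \<Lambda>) - A) \<in> O(\<lambda>n. real n powr 0)"
          by (rule sum_in_bigo(2))
        then show "(\<lambda>n. M\<^sub>0 n - M\<^sub>0 (Suc n)) \<in> O(\<lambda>n. real n powr 0)"
          by (simp add: M\<^sub>0_def algebra_simps)
      qed
      show "(\<lambda>n. a\<^sup>2) \<in> O(\<lambda>n. real n powr 0)"
        by real_asymp
      show "(\<lambda>n. 2 * a * ((\<psi> (Suc n) - real (Suc n) powr (2 * \<Lambda>)) * z (Suc n))) \<in> O(\<lambda>n. real n powr 0)"
        by (rule *[OF bigo_powr_mult[OF bigo_powr_Suc[OF \<psi>] bigo_powr_Suc[OF z_bigo]]]) simp
    qed
  qed simp
  show summable: "summable (\<lambda>j. L (Suc j))"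
    by (rule summable_comparison_test_bigo[OF _ L_bigo]) (use \<Lambda> in \<open>simp add: summable_real_powr_iff\<close>)
  define z\<^sub>1 z\<^sub>2 where "z\<^sub>1 = Re (zeta (of_real (2 * \<Lambda> - 1)))" and "z\<^sub>2 = Re (zeta (of_real \<Lambda>))"
  \<comment> \<open>\<open>Z\<^sub>1\<close>, \<open>Z\<^sub>2\<close> and \<open>H\<close> are the
    errors of the three partial sums after their limits are taken out. All are of order
    \<open>n powr (1 - 2 * \<Lambda>)\<close>, so multiplication by
    \<open>n powr (2 * \<Lambda>)\<close> makes them O(n).\<close>
  define Z\<^sub>1 where "Z\<^sub>1 n = (\<Sum>k<n. real (Suc k) powr (1 - 2 * \<Lambda>)) - real n powr (2 - 2 * \<Lambda>) / (2 - 2 * \<Lambda>) - z\<^sub>1" for n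
  define Z\<^sub>2 where "Z\<^sub>2 n = (\<Sum>k<n. real (Suc k) powr (-\<Lambda>)) - real n powr (1 - \<Lambda>) / (1 - \<Lambda>) - z\<^sub>2" for n
  define H where "H n = (\<Sum>j<n. L (Suc j)) - (\<Sum>j. L (Suc j))" for n
  have Z\<^sub>1: "Z\<^sub>1 \<in> O(\<lambda>n. real n powr (1 - 2 * \<Lambda>))"
    using zeta_partial_sums[of "2 * \<Lambda> - 1"] \<Lambda> by (simp add: Z\<^sub>1_def[abs_def] z\<^sub>1_def)
  have Z\<^sub>2: "Z\<^sub>2 \<in> O(\<lambda>n. real n powr (1 - 2 * \<Lambda>))"
    by (rule bigo_powr_mono[of _ "-\<Lambda>"])
      (use zeta_partial_sums[of \<Lambda>] \<Lambda> in \<open>simp_all add: Z\<^sub>2_def[abs_def] z\<^sub>2_def\<close>)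
  have H: "H \<in> O(\<lambda>n. real n powr (1 - 2 * \<Lambda>))"
    unfolding H_def
  proof (rule bigo_of_increments)
    show "(\<lambda>n. \<Sum>j<n. L (Suc j)) \<longlonglongrightarrow> (\<Sum>j. L (Suc j))"
      using summable by (rule summable_LIMSEQ)
  qed (use L_bigo \<Lambda> in simp_all)
  define C where "C = S 0 / \<psi> 0 + (\<Sum>j. L (Suc j)) + 2 * a\<^sup>2 / (1 - \<Lambda>) * z\<^sub>1 + 2 * a * K * z\<^sub>2"
  define E where "E n = H n + 2 * a * A * Z\<^sub>1 n + 2 * a * K * Z\<^sub>2 n" for n
  define Q where "Q n = C + A\<^sup>2 * real n powr (2 - 2 * \<Lambda>) + 2 * A * K * real n powr (1 - \<Lambda>)" for n :: nat
  have E: "E \<in> O(\<lambda>n. real n powr (1 - 2 * \<Lambda>))"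
    unfolding E_def
    by (intro sum_in_bigo(1) H landau_o.big.cmult_in_iff'[THEN iffD2]) (use Z\<^sub>1 Z\<^sub>2 in \<open>auto intro: landau_o.big.mult_in_1\<close>)
  have S_div: "S n / \<psi> n = Q n + E n" for n
  proof -
    have "S n / \<psi> n = S 0 / \<psi> 0 + (\<Sum>j<n. L (Suc j) + 2 * a * z (Suc j))"
    proof (induction n)
      case (Suc n)
      have "S (Suc n) / \<psi> (Suc n) - S n / \<psi> n = g n * inverse (\<psi> (Suc n))"
        by (rule linear_recursion_increment[of S n \<alpha> g \<psi>, OF _ \<psi>_Suc \<psi>_nz]) (simp add: g_def S_Suc)
      then show ?case
        using Suc by (simp add: L_eq)
    qed simp
    also have "(\<Sum>j<n. L (Suc j) + 2 * a * z (Suc j))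
      = (\<Sum>j<n. L (Suc j)) + 2 * a * A * (\<Sum>j<n. real (Suc j) powr (1 - 2 * \<Lambda>)) + 2 * a * K * (\<Sum>j<n. real (Suc j) powr (-\<Lambda>))"
      by (simp add: z_def sum.distrib sum_distrib_left algebra_simps del: of_nat_Suc)
    also have "S 0 / \<psi> 0 + \<dots> = S 0 / \<psi> 0 + (H n + (\<Sum>j. L (Suc j))) + 2 * a * A * (Z\<^sub>1 n + real n powr (2 - 2 * \<Lambda>) / (2 - 2 * \<Lambda>) + z\<^sub>1)
        + 2 * a * K * (Z\<^sub>2 n + real n powr (1 - \<Lambda>) / (1 - \<Lambda>) + z\<^sub>2)"
      by (simp add: H_def Z\<^sub>1_def Z\<^sub>2_def)
    also have "\<dots> = C + E n + 2 * a * A * (real n powr (2 - 2 * \<Lambda>) / (2 - 2 * \<Lambda>)) + 2 * a * K * (real n powr (1 - \<Lambda>) / (1 - \<Lambda>))"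
      by (simp add: C_def E_def A_def algebra_simps power2_eq_square)
    \<comment> \<open>Here \<open>A = a / (1 - \<Lambda>)\<close> turns the summation constants into
      the coefficients of the square of \<open>M\<^sub>0\<close>; this is what makes the growing
      terms cancel later.\<close>
    also have "2 * a * A * (real n powr (2 - 2 * \<Lambda>) / (2 - 2 * \<Lambda>)) = A\<^sup>2 * real n powr (2 - 2 * \<Lambda>)"
    proof -
      have "x / (2 - 2 * \<Lambda>) = x / (1 - \<Lambda>) / 2" for x
        using \<Lambda> by (simp add: field_simps)
      moreover have "2 * a * A * (x / 2) = a * A * x" for x
        by simp
      moreover have "a * A * (x / (1 - \<Lambda>)) = A\<^sup>2 * x" for x
        by (simp add: A_def power2_eq_square)
      ultimately show ?thesis
        by (simp only:)
    qed
    also have "2 * a * K * (real n powr (1 - \<Lambda>) / (1 - \<Lambda>)) = 2 * A * K * real n powr (1 - \<Lambda>)"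
      by (simp add: A_def)
    finally show ?thesis
      by (simp add: Q_def)
  qed
  have QE: "(\<lambda>n. Q n + E n) \<in> O(\<lambda>n. real n powr (2 - 2 * \<Lambda>))"
  proof (rule sum_in_bigo(1))
    show "Q \<in> O(\<lambda>n. real n powr (2 - 2 * \<Lambda>))"
      unfolding Q_def
    proof (intro sum_in_bigo(1))
      show "(\<lambda>n. C) \<in> O(\<lambda>n. real n powr (2 - 2 * \<Lambda>))"
        using \<Lambda> by real_asymp
    qed (use \<Lambda> in \<open>auto simp: landau_o.big.cmult_in_iff' intro!: powr_bigo_powr\<close>)
    show "E \<in> O(\<lambda>n. real n powr (2 - 2 * \<Lambda>))"
      by (rule bigo_powr_mono[OF E]) simp
  qed
  \<comment> \<open>For \<open>n > 0\<close> this is exactly the variance minus its claimed leading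
    term: \<open>n powr (2 * \<Lambda>) * Q n\<close> and the square of \<open>M\<^sub>0 n\<close>
    share their terms of order n^2 and n^(1 + \<Lambda>).\<close>
  have "(\<lambda>n. (\<psi> n - real n powr (2 * \<Lambda>)) * (Q n + E n) + real n powr (2 * \<Lambda>) * E n
      - (M n - M\<^sub>0 n) * (M n + M\<^sub>0 n)) \<in> O(\<lambda>n. real n powr 1)"
  proof (intro sum_in_bigo(2)[OF sum_in_bigo(1)])
    show "(\<lambda>n. (\<psi> n - real n powr (2 * \<Lambda>)) * (Q n + E n)) \<in> O(\<lambda>n. real n powr 1)"
      by (rule bigo_powr_mult[OF \<psi> QE]) simp
    show "(\<lambda>n. real n powr (2 * \<Lambda>) * E n) \<in> O(\<lambda>n. real n powr 1)"
      by (rule bigo_powr_mult[OF landau_o.big_refl E]) simp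
    have "(\<lambda>n. M n + M\<^sub>0 n) \<in> O(\<lambda>n. real n powr 1)"
      by (rule sum_in_bigo(1)[OF M_bigo M\<^sub>0_bigo])
    then show "(\<lambda>n. (M n - M\<^sub>0 n) * (M n + M\<^sub>0 n)) \<in> O(\<lambda>n. real n powr 1)"
      unfolding M\<^sub>0_def by (rule bigo_powr_mult[OF M]) simp
  qed
  then have *: "(\<lambda>n. (\<psi> n - real n powr (2 * \<Lambda>)) * (Q n + E n) + real n powr (2 * \<Lambda>) * E n
      - (M n - M\<^sub>0 n) * (M n + M\<^sub>0 n)) \<in> O(\<lambda>n. real n)"
    by simp
  have "(\<lambda>n. S n - (M n)\<^sup>2 - (C - K\<^sup>2) * real n powr (2 * \<Lambda>)) \<in> O(\<lambda>n. real n)"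
  proof (rule landau_o.big.in_cong[THEN iffD1, OF _ *])
    show "eventually (\<lambda>n. (\<psi> n - real n powr (2 * \<Lambda>)) * (Q n + E n) + real n powr (2 * \<Lambda>) * E n
        - (M n - M\<^sub>0 n) * (M n + M\<^sub>0 n) = S n - (M n)\<^sup>2 - (C - K\<^sup>2) * real n powr (2 * \<Lambda>)) sequentially"
      using eventually_gt_at_top[of 0]
    proof eventually_elim
      case (elim n)
      have S: "S n = \<psi> n * (Q n + E n)"
        using S_div[of n] \<psi>_nz[of n] by (simp add: field_simps)
      have "x powr (2 * \<Lambda>) * (C + A\<^sup>2 * x powr (2 - 2 * \<Lambda>) + 2 * A * K * x powr (1 - \<Lambda>))
        = C * x powr (2 * \<Lambda>) + A\<^sup>2 * x\<^sup>2 + 2 * A * K * (x * x powr \<Lambda>)" if "x > 0" for x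
      proof -
        have "x powr (2 * \<Lambda>) * x powr (2 - 2 * \<Lambda>) = x\<^sup>2"
          "x powr (2 * \<Lambda>) * x powr (1 - \<Lambda>) = x * x powr \<Lambda>"
          using that powr_add[of x 1 \<Lambda>] powr_add[of x \<Lambda> 1] by (simp_all flip: powr_add powr_numeral)
        then show ?thesis
          by (simp only: distrib_left mult.left_commute[of "x powr (2 * \<Lambda>)"] mult.commute[of "x powr (2 * \<Lambda>)" C])
      qed
      then have Q: "real n powr (2 * \<Lambda>) * Q n
        = C * real n powr (2 * \<Lambda>) + A\<^sup>2 * (real n)\<^sup>2 + 2 * A * K * (real n * real n powr \<Lambda>)"
        using elim by (simp add: Q_def)
      have "real n powr (2 * \<Lambda>) = (real n powr \<Lambda>)\<^sup>2"
        by (simp add: power2_eq_square flip: powr_add)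
      then have M\<^sub>0: "(M\<^sub>0 n)\<^sup>2 = A\<^sup>2 * (real n)\<^sup>2 + 2 * A * K * (real n * real n powr \<Lambda>) + K\<^sup>2 * real n powr (2 * \<Lambda>)"
        by (simp add: M\<^sub>0_def power2_eq_square algebra_simps)
      have "(\<psi> n - real n powr (2 * \<Lambda>)) * (Q n + E n) + real n powr (2 * \<Lambda>) * E n - (M n - M\<^sub>0 n) * (M n + M\<^sub>0 n)
        = S n - real n powr (2 * \<Lambda>) * Q n - (M n)\<^sup>2 + (M\<^sub>0 n)\<^sup>2"
        unfolding S by (simp add: power2_eq_square algebra_simps)
      then show ?case
        unfolding Q M\<^sub>0 by (simp add: algebra_simps)
    qed
  qed
  then show "(\<lambda>n. S n - (M n)\<^sup>2
        - (S 0 / \<psi> 0 + (\<Sum>j. L (Suc j)) + 2 * a\<^sup>2 / (1 - \<Lambda>) * Re (zeta (of_real (2 * \<Lambda> - 1)))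
           + 2 * a * K * Re (zeta (of_real \<Lambda>)) - K\<^sup>2) * real n powr (2 * \<Lambda>)) \<in> O(\<lambda>n. real n)"
    unfolding C_def z\<^sub>1_def z\<^sub>2_def .
qed

section \<open>The draws and their conditional law\<close>

context urn_process
begin

lemma space_draw_algebra [simp]: "space (draw_algebra P X n) = space P"
  unfolding draw_algebra_def by (rule space_measure_of) auto

lemma sets_draw_algebra:
  "sets (draw_algebra P X n) = sigma_sets (space P) {X i -` A \<inter> space P | i A. 1 \<le> i \<and> i \<le> n}"
  unfolding draw_algebra_def by (rule sets_measure_of) auto

lemma draw_le: "\<omega> \<in> space P \<Longrightarrow> X (Suc n) \<omega> \<le> m"
  using measurable_space[OF draw_measurable] by auto

lemma draw_measurable_draw_algebra:
  assumes "1 \<le> i" "i \<le> n"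
  shows "X i \<in> draw_algebra P X n \<rightarrow>\<^sub>M count_space UNIV"
  by (rule measurableI) (use assms in \<open>auto simp: sets_draw_algebra intro!: sigma_sets.Basic\<close>)

lemma subalgebra_draw_algebra: "subalgebra P (draw_algebra P X n)"
  unfolding subalgebra_def sets_draw_algebra
proof (intro conjI sets.sigma_sets_subset)
  show "{X i -` A \<inter> space P | i A. 1 \<le> i \<and> i \<le> n} \<subseteq> sets P"
  proof safe
    fix i :: nat and A assume "1 \<le> i"
    then obtain j where j: "i = Suc j"
      by (cases i) auto
    \<comment> \<open>Measurability of \<open>X\<close> is assumed only towards
      \<open>{0..m}\<close>, so \<open>A\<close> is first cut down to that range.\<close>
    have "X i -` A \<inter> space P = X i -` (A \<inter> {0..m}) \<inter> space P"
      using draw_le[of _ j] j by auto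
    also have "\<dots> \<in> sets P"
      unfolding j by (rule measurable_sets[OF draw_measurable]) simp
    finally show "X i -` A \<inter> space P \<in> sets P" .
  qed
qed simp

lemma draw_algebra_Suc: "subalgebra (draw_algebra P X (Suc n)) (draw_algebra P X n)"
  unfolding subalgebra_def sets_draw_algebra
  by (auto intro!: sigma_sets_mono') force

sublocale finite_measure_subalgebra P "draw_algebra P X n" for n
  by unfold_locales (rule subalgebra_draw_algebra)

lemma draws_process_measurable:
  fixes Z :: "nat \<Rightarrow> 'w \<Rightarrow> int"
  assumes "\<And>\<omega>. \<omega> \<in> space P \<Longrightarrow> Z 0 \<omega> = z"
    and "\<And>n \<omega>. \<omega> \<in> space P \<Longrightarrow> Z (Suc n) \<omega> = Z n \<omega> + f (m - X (Suc n) \<omega>)"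
  shows "Z n \<in> draw_algebra P X n \<rightarrow>\<^sub>M count_space UNIV"
proof (induction n)
  case 0
  have "(\<lambda>_. z) \<in> draw_algebra P X 0 \<rightarrow>\<^sub>M count_space UNIV"
    by simp
  then show ?case
    by (rule measurable_cong[THEN iffD2, rotated]) (simp add: assms)
next
  case (Suc n)
  have X: "X (Suc n) \<in> draw_algebra P X (Suc n) \<rightarrow>\<^sub>M count_space UNIV"
    by (rule draw_measurable_draw_algebra) auto
  have Z: "Z n \<in> draw_algebra P X (Suc n) \<rightarrow>\<^sub>M count_space UNIV"
    by (rule measurable_from_subalg[OF draw_algebra_Suc Suc])
  have "(\<lambda>\<omega>. Z n \<omega> + f (m - X (Suc n) \<omega>)) \<in> draw_algebra P X (Suc n) \<rightarrow>\<^sub>M count_space UNIV"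
    by (rule measurable_compose_countable[OF measurable_compose[OF Z] X]) simp
  then show ?case
    by (rule measurable_cong[THEN iffD2, rotated]) (simp add: assms)
qed

lemma white_measurable: "W n \<in> draw_algebra P X n \<rightarrow>\<^sub>M count_space UNIV"
  and black_measurable: "B n \<in> draw_algebra P X n \<rightarrow>\<^sub>M count_space UNIV"
  by (rule draws_process_measurable; (rule white_0 white_Suc black_0 black_Suc, assumption))+

lemma sample_prob_measurable:
  "(\<lambda>\<omega>. sample_prob model m (nat (W n \<omega>)) (nat (B n \<omega>)) k) \<in> borel_measurable (draw_algebra P X n)"
  by (rule measurable_compose_countable[OF measurable_compose[OF black_measurable] white_measurable])
    (rule measurable_count_space_eq1[THEN iffD2], simp)

text \<open>The conditional law is given only for the events that a draw equals \<open>k\<close>. As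
  a draw takes finitely many values, \<open>g\<close> of it is a finite combination of their
  indicators, and the bounded factor \<open>Y\<close>, known from the past, can be pulled through
  each of them.\<close>

lemma expectation_draw:
  fixes Y :: "'w \<Rightarrow> real" and g :: "nat \<Rightarrow> real"
  assumes Y: "Y \<in> borel_measurable (draw_algebra P X n)"
    and bound: "\<And>\<omega>. \<omega> \<in> space P \<Longrightarrow> \<bar>Y \<omega>\<bar> \<le> c"
  shows "expectation (\<lambda>\<omega>. Y \<omega> * g (X (Suc n) \<omega>))
    = expectation (\<lambda>\<omega>. Y \<omega> * (\<Sum>k\<le>m. g k * sample_prob model m (nat (W n \<omega>)) (nat (B n \<omega>)) k))"
    (is "_ = expectation (\<lambda>\<omega>. Y \<omega> * (\<Sum>k\<le>m. g k * ?p k \<omega>))")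
proof -
  define I :: "nat \<Rightarrow> 'w \<Rightarrow> real" where "I k = indicator {\<omega> \<in> space P. X (Suc n) \<omega> = k}" for k
  have Y' [measurable]: "Y \<in> borel_measurable P"
    by (rule measurable_from_subalg[OF subalgebra_draw_algebra Y])
  have p [measurable]: "?p k \<in> borel_measurable P" for k
    by (rule measurable_from_subalg[OF subalgebra_draw_algebra sample_prob_measurable])
  have X: "X (Suc n) \<in> P \<rightarrow>\<^sub>M count_space UNIV"
    by (rule measurable_from_subalg[OF subalgebra_draw_algebra draw_measurable_draw_algebra]) auto
  have I [measurable]: "I k \<in> borel_measurable P" for k
    unfolding I_def using measurable_sets[OF X, of "{k}"]
    by (intro borel_measurable_indicator) (simp add: vimage_def Int_def conj_commute)
  have int: "integrable P (\<lambda>\<omega>. Y \<omega> * I k \<omega>)" for k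
  proof (rule integrable_const_bound[where B = c])
    \<comment> \<open>The space is nonempty, so a bound of absolute values is nonnegative; this is
      needed where the indicator vanishes.\<close>
    have "c \<ge> 0"
      using not_empty bound by (meson abs_ge_zero equals0I order_trans)
    then show "AE \<omega> in P. norm (Y \<omega> * I k \<omega>) \<le> c"
      using bound by (intro AE_I2) (auto simp: I_def indicator_def)
  qed simp
  have law: "AE \<omega> in P. real_cond_exp P (draw_algebra P X n) (I k) \<omega> = ?p k \<omega>" if "k \<le> m" for k
    using draw_law[OF that] by (simp add: I_def)
  have int_p: "integrable P (\<lambda>\<omega>. Y \<omega> * ?p k \<omega>)"
    and exp_p: "expectation (\<lambda>\<omega>. Y \<omega> * ?p k \<omega>) = expectation (\<lambda>\<omega>. Y \<omega> * I k \<omega>)" if "k \<le> m" for k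
  proof -
    have ae: "AE \<omega> in P. Y \<omega> * real_cond_exp P (draw_algebra P X n) (I k) \<omega> = Y \<omega> * ?p k \<omega>"
      using law[OF that] by eventually_elim simp
    show "integrable P (\<lambda>\<omega>. Y \<omega> * ?p k \<omega>)"
      using real_cond_exp_intg(1)[OF int Y I]
      by (rule integrable_cong_AE[THEN iffD1, rotated 3]) (use ae in auto)
    show "expectation (\<lambda>\<omega>. Y \<omega> * ?p k \<omega>) = expectation (\<lambda>\<omega>. Y \<omega> * I k \<omega>)"
      unfolding real_cond_exp_intg(2)[OF int Y I, symmetric]
      by (rule integral_cong_AE) (use ae in auto)
  qed
  have "expectation (\<lambda>\<omega>. Y \<omega> * g (X (Suc n) \<omega>)) = expectation (\<lambda>\<omega>. \<Sum>k\<le>m. g k * (Y \<omega> * I k \<omega>))"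
  proof (rule Bochner_Integration.integral_cong)
    fix \<omega> assume \<omega>: "\<omega> \<in> space P"
    have "(\<Sum>k\<le>m. g k * (Y \<omega> * I k \<omega>)) = (\<Sum>k\<le>m. if X (Suc n) \<omega> = k then g k * Y \<omega> else 0)"
      by (rule sum.cong) (auto simp: I_def \<omega>)
    then show "Y \<omega> * g (X (Suc n) \<omega>) = (\<Sum>k\<le>m. g k * (Y \<omega> * I k \<omega>))"
      using draw_le[OF \<omega>, of n] by simp
  qed simp
  also have "\<dots> = (\<Sum>k\<le>m. g k * expectation (\<lambda>\<omega>. Y \<omega> * I k \<omega>))"
    by (subst Bochner_Integration.integral_sum) (use int in auto)
  also have "\<dots> = (\<Sum>k\<le>m. g k * expectation (\<lambda>\<omega>. Y \<omega> * ?p k \<omega>))"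
    by (simp add: exp_p)
  also have "\<dots> = expectation (\<lambda>\<omega>. \<Sum>k\<le>m. g k * (Y \<omega> * ?p k \<omega>))"
    by (subst Bochner_Integration.integral_sum) (use int_p in auto)
  also have "\<dots> = expectation (\<lambda>\<omega>. Y \<omega> * (\<Sum>k\<le>m. g k * ?p k \<omega>))"
    by (simp add: sum_distrib_left mult_ac)
  finally show ?thesis .
qed

text \<open>The conditional law is tested against the past event that the value \<open>k\<close> has
  probability zero: the chance that this event occurs and \<open>k\<close> is drawn nevertheless
  integrates to 0. Finitely many \<open>k\<close> suffice.\<close>

lemma AE_sample_prob_pos:
  "AE \<omega> in P. sample_prob model m (nat (W n \<omega>)) (nat (B n \<omega>)) (X (Suc n) \<omega>) \<noteq> 0"
proof -
  let ?p = "\<lambda>k \<omega>. sample_prob model m (nat (W n \<omega>)) (nat (B n \<omega>)) k"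
  have X: "X (Suc n) \<in> P \<rightarrow>\<^sub>M count_space UNIV"
    by (rule measurable_from_subalg[OF subalgebra_draw_algebra draw_measurable_draw_algebra]) auto
  have "AE \<omega> in P. X (Suc n) \<omega> = k \<longrightarrow> ?p k \<omega> \<noteq> 0" if k: "k \<le> m" for k
  proof -
    define Y :: "'w \<Rightarrow> real" where "Y = (\<lambda>\<omega>. if ?p k \<omega> = 0 then 1 else 0)"
    define g :: "nat \<Rightarrow> real" where "g = (\<lambda>j. if j = k then 1 else 0)"
    have Y: "Y \<in> borel_measurable (draw_algebra P X n)"
      unfolding Y_def using sample_prob_measurable by measurable
    have [measurable]: "Y \<in> borel_measurable P"
      by (rule measurable_from_subalg[OF subalgebra_draw_algebra Y])
    have [measurable]: "(\<lambda>\<omega>. g (X (Suc n) \<omega>)) \<in> borel_measurable P"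
      by (rule measurable_compose[OF X]) simp
    have "(\<Sum>j\<le>m. g j * ?p j \<omega>) = ?p k \<omega>" for \<omega>
      using k unfolding g_def by (simp add: if_distrib[of "\<lambda>x. x * _"] cong: if_cong)
    then have "expectation (\<lambda>\<omega>. Y \<omega> * g (X (Suc n) \<omega>)) = expectation (\<lambda>\<omega>. Y \<omega> * ?p k \<omega>)"
      by (subst expectation_draw[OF Y, of 1]) (auto simp: Y_def)
    also have "\<dots> = 0"
      by (simp add: Y_def if_distrib[of "\<lambda>x. x * _"] cong: if_cong)
    finally have "expectation (\<lambda>\<omega>. Y \<omega> * g (X (Suc n) \<omega>)) = 0" .
    moreover have "integrable P (\<lambda>\<omega>. Y \<omega> * g (X (Suc n) \<omega>))"
      by (rule integrable_const_bound[where B = 1]) (simp add: Y_def g_def, measurable)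
    ultimately have "AE \<omega> in P. Y \<omega> * g (X (Suc n) \<omega>) = 0"
      by (subst (asm) integral_nonneg_eq_0_iff_AE) (auto simp: Y_def g_def)
    then show ?thesis
      by eventually_elim (auto simp: Y_def g_def split: if_splits)
  qed
  then have "AE \<omega> in P. \<forall>k\<in>{..m}. X (Suc n) \<omega> = k \<longrightarrow> ?p k \<omega> \<noteq> 0"
    by (intro AE_finite_allI) auto
  then show ?thesis
    using AE_space by eventually_elim (use draw_le in auto)
qed

end

section \<open>Moment recursions of the urn\<close>

locale tenable_affine_urn = urn_process +
  fixes \<sigma> :: nat
  assumes sample_size_pos: "m \<ge> 1" and balance_pos: "\<sigma> \<ge> 1" and sample_size_le: "m \<le> W\<^sub>0 + B\<^sub>0"
    and balanced: "balanced_urn m \<sigma> a b"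
    and tenable: "tenable_urn model m a b"
    and affine: "affine_urn m a"
    and drift_pos: "int (W\<^sub>0 + B\<^sub>0) + int m * (a (m - 1) - a m) > 0"
begin

definition T :: "nat \<Rightarrow> real" where "T n = real (W\<^sub>0 + B\<^sub>0) + real \<sigma> * real n"
definition d :: real where "d = urn_diff m a"
definition a\<^sub>m :: real where "a\<^sub>m = real_of_int (a m)"
definition U :: "nat \<Rightarrow> 'a \<Rightarrow> real" where "U n \<omega> = real_of_int (W n \<omega>)"
definition M :: "nat \<Rightarrow> real" where "M n = expectation (U n)"
definition S :: "nat \<Rightarrow> real" where "S n = expectation (\<lambda>\<omega>. (U n \<omega>)\<^sup>2)"

lemma T_ge: "T n \<ge> real m + real n"
proof -
  have "real \<sigma> * real n \<ge> 1 * real n"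
    using balance_pos by (intro mult_right_mono) auto
  then show ?thesis
    using sample_size_le unfolding T_def by linarith
qed

lemma T_pos: "T n > 0"
  using T_ge[of n] sample_size_pos by linarith

lemma white_black_total:
  assumes "\<omega> \<in> space P"
  shows "W n \<omega> + B n \<omega> = int (W\<^sub>0 + B\<^sub>0) + int \<sigma> * int n"
proof (induction n)
  case 0
  then show ?case
    using assms by (simp add: white_0 black_0)
next
  case (Suc n)
  have "a (m - X (Suc n) \<omega>) + b (m - X (Suc n) \<omega>) = int \<sigma>"
    using balanced unfolding balanced_urn_def by simp
  then show ?case
    using Suc assms by (simp add: white_Suc black_Suc algebra_simps)
qed

lemma white_step:
  assumes "\<omega> \<in> space P"
  shows "U (Suc n) \<omega> = U n \<omega> + a\<^sub>m + d * real (X (Suc n) \<omega>)"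
proof -
  define x where "x = X (Suc n) \<omega>"
  have "x \<le> m"
    using draw_le[OF assms] by (simp add: x_def)
  then have "int (m - x) = int m - int x"
    by simp
  then have "a (m - x) = int x * a (m - 1) - (int x - 1) * a m"
    using affine[unfolded affine_urn_def, rule_format, of "m - x"] by simp
  then have "a (m - x) = a m + (a (m - 1) - a m) * int x"
    by (simp add: algebra_simps)
  then have "real_of_int (a (m - x)) = a\<^sub>m + d * real x"
    by (simp add: a\<^sub>m_def d_def urn_diff_def)
  then show ?thesis
    using assms by (simp add: U_def white_Suc x_def)
qed

text \<open>A sample of nonzero probability contains, without replacement, at most the balls
  present, and, with replacement, only colours present. Tenability bounds the removals by exactly
  these amounts. Both colours must be carried through the induction together.\<close>

lemma AE_nonneg: "AE \<omega> in P. W n \<omega> \<ge> 0 \<and> B n \<omega> \<ge> 0"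
proof (induction n)
  case 0
  then show ?case
    using AE_space by eventually_elim (simp add: white_0 black_0)
next
  case (Suc n)
  have step: "W (Suc n) \<omega> \<ge> 0 \<and> B (Suc n) \<omega> \<ge> 0"
    if nonneg: "W n \<omega> \<ge> 0 \<and> B n \<omega> \<ge> 0" and \<omega>: "\<omega> \<in> space P"
      and pos: "sample_prob model m (nat (W n \<omega>)) (nat (B n \<omega>)) (X (Suc n) \<omega>) \<noteq> 0" for \<omega>
  proof -
    define x where "x = X (Suc n) \<omega>"
    have x: "x \<le> m"
      using draw_le[OF \<omega>] by (simp add: x_def)
    have "W n \<omega> + a (m - x) \<ge> 0 \<and> B n \<omega> + b (m - x) \<ge> 0"
    proof (cases model)
      case Without_Replacement
      with pos have "x \<le> nat (W n \<omega>)" "m - x \<le> nat (B n \<omega>)"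
        by (auto simp: x_def[symmetric] not_less[symmetric] binomial_eq_0)
      moreover have "a (m - x) \<ge> - (int m - int (m - x))" "b (m - x) \<ge> - int (m - x)"
        using tenable Without_Replacement by auto
      ultimately show ?thesis
        using x nonneg by linarith
    next
      case With_Replacement
      with pos have *: "W n \<omega> > 0 \<or> x = 0" "B n \<omega> > 0 \<or> x = m"
        using x by (auto simp: x_def[symmetric])
      have a: "\<forall>k<m. a k \<ge> -1" "a m \<ge> 0" and b: "\<forall>k. 1 \<le> k \<and> k \<le> m \<longrightarrow> b k \<ge> -1" "b 0 \<ge> 0"
        using tenable With_Replacement by auto
      have "W n \<omega> + a (m - x) \<ge> 0"
      proof (cases "x = 0")
        case False
        then have "a (m - x) \<ge> -1"
          using a(1) sample_size_pos by simp
        then show ?thesis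
          using *(1) False by linarith
      qed (use a nonneg in auto)
      moreover have "B n \<omega> + b (m - x) \<ge> 0"
      proof (cases "x = m")
        case False
        then have "b (m - x) \<ge> -1"
          using b(1) x by simp
        then show ?thesis
          using *(2) False by linarith
      qed (use b nonneg in auto)
      ultimately show ?thesis ..
    qed
    then show ?thesis
      using \<omega> by (simp add: white_Suc black_Suc x_def)
  qed
  show ?case
    using Suc AE_space AE_sample_prob_pos[of n] by eventually_elim (rule step)
qed

lemma U_measurable: "U n \<in> borel_measurable (draw_algebra P X n)"
  unfolding U_def by (rule measurable_compose[OF white_measurable]) simp

lemma U_measurable' [measurable]: "U n \<in> borel_measurable P"
  by (rule measurable_from_subalg[OF subalgebra_draw_algebra U_measurable])

lemma draw_measurable' [measurable]: "(\<lambda>\<omega>. real (X (Suc n) \<omega>)) \<in> borel_measurable P"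
  by (rule measurable_compose[OF draw_measurable]) simp

lemma U_bounded: "\<exists>c\<ge>0. \<forall>\<omega>\<in>space P. \<bar>U n \<omega>\<bar> \<le> c"
proof (induction n)
  case 0
  then show ?case
    by (intro exI[of _ "real W\<^sub>0"]) (simp add: U_def white_0)
next
  case (Suc n)
  then obtain c where c: "c \<ge> 0" "\<forall>\<omega>\<in>space P. \<bar>U n \<omega>\<bar> \<le> c"
    by blast
  have "\<bar>U (Suc n) \<omega>\<bar> \<le> c + \<bar>a\<^sub>m\<bar> + \<bar>d\<bar> * real m" if "\<omega> \<in> space P" for \<omega>
  proof -
    have "\<bar>d * real (X (Suc n) \<omega>)\<bar> \<le> \<bar>d\<bar> * real m"
      unfolding abs_mult using draw_le[OF that, of n] by (intro mult_left_mono) auto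
    moreover have "\<bar>U n \<omega>\<bar> \<le> c"
      using c that by blast
    ultimately show ?thesis
      unfolding white_step[OF that] by linarith
  qed
  then show ?case
    using c(1) by (intro exI[of _ "c + \<bar>a\<^sub>m\<bar> + \<bar>d\<bar> * real m"]) auto
qed

lemma integrable_U: "integrable P (U n)"
  and integrable_U2: "integrable P (\<lambda>\<omega>. (U n \<omega>)\<^sup>2)"
  and integrable_X: "integrable P (\<lambda>\<omega>. real (X (Suc n) \<omega>))"
  and integrable_X2: "integrable P (\<lambda>\<omega>. (real (X (Suc n) \<omega>))\<^sup>2)"
  and integrable_UX: "integrable P (\<lambda>\<omega>. U n \<omega> * real (X (Suc n) \<omega>))"
proof -
  obtain c where c: "c \<ge> 0" "\<And>\<omega>. \<omega> \<in> space P \<Longrightarrow> \<bar>U n \<omega>\<bar> \<le> c"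
    using U_bounded by blast
  have X: "real (X (Suc n) \<omega>) \<le> real m" if "\<omega> \<in> space P" for \<omega>
    using draw_le[OF that] by simp
  show "integrable P (U n)"
    by (rule integrable_const_bound[where B = c]) (use c in \<open>auto intro!: AE_I2\<close>)
  show "integrable P (\<lambda>\<omega>. (U n \<omega>)\<^sup>2)"
    by (rule integrable_const_bound[where B = "c\<^sup>2"])
      (use c in \<open>auto intro!: AE_I2 simp: abs_le_square_iff[symmetric]\<close>)
  show "integrable P (\<lambda>\<omega>. real (X (Suc n) \<omega>))"
    by (rule integrable_const_bound[where B = "real m"]) (use X in \<open>auto intro!: AE_I2\<close>)
  show "integrable P (\<lambda>\<omega>. (real (X (Suc n) \<omega>))\<^sup>2)"
    by (rule integrable_const_bound[where B = "(real m)\<^sup>2"])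
      (use X in \<open>auto intro!: AE_I2 power_mono\<close>)
  show "integrable P (\<lambda>\<omega>. U n \<omega> * real (X (Suc n) \<omega>))"
    by (rule integrable_const_bound[where B = "c * real m"])
      (use c X in \<open>auto intro!: AE_I2 mult_mono simp: abs_mult\<close>)
qed

text \<open>Holds only almost surely: the total of the two truncated counts is \<open>T n\<close>
  just where neither colour is negative.\<close>

lemma AE_sample_moments:
  "AE \<omega> in P. (\<Sum>k\<le>m. real k * sample_prob model m (nat (W n \<omega>)) (nat (B n \<omega>)) k)
      = real m / T n * U n \<omega>
    \<and> (\<Sum>k\<le>m. (real k)\<^sup>2 * sample_prob model m (nat (W n \<omega>)) (nat (B n \<omega>)) k)
      = pair_coeff model m (T n) * (U n \<omega>)\<^sup>2 + (real m / T n - same_ball_coeff model m (T n)) * U n \<omega>"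
  using AE_nonneg[of n] AE_space
proof eventually_elim
  case (elim \<omega>)
  define w c where "w = nat (W n \<omega>)" and "c = nat (B n \<omega>)"
  have w: "real w = U n \<omega>"
    using elim by (simp add: w_def U_def)
  have "int (w + c) = int (W\<^sub>0 + B\<^sub>0 + \<sigma> * n)"
    using elim white_black_total[of \<omega> n] by (simp add: w_def c_def)
  then have wc: "w + c = W\<^sub>0 + B\<^sub>0 + \<sigma> * n"
    by (simp only: of_nat_eq_iff)
  then have T: "real (w + c) = T n"
    by (simp add: T_def)
  have le: "w + c \<ge> m"
    using wc sample_size_le by linarith
  have "(real k)\<^sup>2 * sample_prob model m w c k
      = real k * (real k - 1) * sample_prob model m w c k + real k * sample_prob model m w c k" for k
    by (simp add: power2_eq_square algebra_simps)
  then have "(\<Sum>k\<le>m. (real k)\<^sup>2 * sample_prob model m w c k)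
    = (\<Sum>k\<le>m. real k * (real k - 1) * sample_prob model m w c k) + (\<Sum>k\<le>m. real k * sample_prob model m w c k)"
    by (simp only: sum.distrib)
  then show ?case
    unfolding w_def[symmetric] c_def[symmetric]
    by (simp only: sample_prob_mean[OF sample_size_pos le] T w
        sample_prob_second_factorial_moment[OF sample_size_pos le])
      (simp add: algebra_simps)
qed

lemma expectation_draw_mean:
  assumes Y: "Y \<in> borel_measurable (draw_algebra P X n)"
    and bound: "\<And>\<omega>. \<omega> \<in> space P \<Longrightarrow> \<bar>Y \<omega>\<bar> \<le> c"
  shows "expectation (\<lambda>\<omega>. Y \<omega> * real (X (Suc n) \<omega>)) = real m / T n * expectation (\<lambda>\<omega>. Y \<omega> * U n \<omega>)"
proof -
  have [measurable]: "Y \<in> borel_measurable P"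
    by (rule measurable_from_subalg[OF subalgebra_draw_algebra Y])
  have [measurable]: "(\<lambda>\<omega>. sample_prob model m (nat (W n \<omega>)) (nat (B n \<omega>)) k) \<in> borel_measurable P" for k
    by (rule measurable_from_subalg[OF subalgebra_draw_algebra sample_prob_measurable])
  have "expectation (\<lambda>\<omega>. Y \<omega> * real (X (Suc n) \<omega>)) = expectation (\<lambda>\<omega>. real m / T n * (Y \<omega> * U n \<omega>))"
    by (subst expectation_draw[OF Y, of c], erule bound, rule integral_cong_AE) (use AE_sample_moments[of n] in \<open>auto elim!: eventually_mono\<close>)
  then show ?thesis
    by simp
qed

lemma expectation_draw_square:
  "expectation (\<lambda>\<omega>. (real (X (Suc n) \<omega>))\<^sup>2)
    = pair_coeff model m (T n) * S n + (real m / T n - same_ball_coeff model m (T n)) * M n"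
proof -
  have [measurable]: "(\<lambda>\<omega>. sample_prob model m (nat (W n \<omega>)) (nat (B n \<omega>)) k) \<in> borel_measurable P" for k
    by (rule measurable_from_subalg[OF subalgebra_draw_algebra sample_prob_measurable])
  have "expectation (\<lambda>\<omega>. (real (X (Suc n) \<omega>))\<^sup>2) = expectation (\<lambda>\<omega>. 1 * (real (X (Suc n) \<omega>))\<^sup>2)"
    by simp
  also have "\<dots> = expectation (\<lambda>\<omega>. pair_coeff model m (T n) * (U n \<omega>)\<^sup>2
      + (real m / T n - same_ball_coeff model m (T n)) * U n \<omega>)"
    by (subst expectation_draw[where c = 1], simp, simp, rule integral_cong_AE)
      (use AE_sample_moments[of n] in \<open>auto elim!: eventually_mono\<close>)
  also have "\<dots> = pair_coeff model m (T n) * S n + (real m / T n - same_ball_coeff model m (T n)) * M n"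
    using integrable_U integrable_U2 by (simp add: S_def M_def)
  finally show ?thesis .
qed

lemma M_0: "M 0 = real W\<^sub>0" and S_0: "S 0 = (real W\<^sub>0)\<^sup>2"
proof -
  have "M 0 = expectation (\<lambda>_. real W\<^sub>0)" "S 0 = expectation (\<lambda>_. (real W\<^sub>0)\<^sup>2)"
    unfolding M_def S_def by (rule Bochner_Integration.integral_cong; simp add: U_def white_0)+
  then show "M 0 = real W\<^sub>0" "S 0 = (real W\<^sub>0)\<^sup>2"
    by (simp_all add: prob_space)
qed

lemma M_Suc: "M (Suc n) = (1 + real m * d / T n) * M n + a\<^sub>m"
proof -
  have "M (Suc n) = expectation (\<lambda>\<omega>. U n \<omega> + a\<^sub>m + d * real (X (Suc n) \<omega>))"
    unfolding M_def by (rule Bochner_Integration.integral_cong) (auto simp: white_step)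
  also have "\<dots> = M n + a\<^sub>m + d * expectation (\<lambda>\<omega>. 1 * real (X (Suc n) \<omega>))"
    using integrable_U integrable_X by (simp add: M_def prob_space)
  also have "expectation (\<lambda>\<omega>. 1 * real (X (Suc n) \<omega>)) = real m / T n * expectation (\<lambda>\<omega>. 1 * U n \<omega>)"
    by (rule expectation_draw_mean[where c = 1]) auto
  finally show ?thesis
    by (simp add: M_def algebra_simps)
qed

lemma S_Suc:
  "S (Suc n) = (1 + 2 * real m * d / T n + d\<^sup>2 * pair_coeff model m (T n)) * S n
    + (d\<^sup>2 * (real m / T n - same_ball_coeff model m (T n)) + 2 * real m * a\<^sub>m * d / T n + 2 * a\<^sub>m) * M n + a\<^sub>m\<^sup>2"
proof -
  obtain c where c: "\<And>\<omega>. \<omega> \<in> space P \<Longrightarrow> \<bar>U n \<omega>\<bar> \<le> c"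
    using U_bounded by blast
  have X: "expectation (\<lambda>\<omega>. 1 * real (X (Suc n) \<omega>)) = real m / T n * expectation (\<lambda>\<omega>. 1 * U n \<omega>)"
    by (rule expectation_draw_mean[where c = 1]) auto
  have UX: "expectation (\<lambda>\<omega>. U n \<omega> * real (X (Suc n) \<omega>)) = real m / T n * expectation (\<lambda>\<omega>. U n \<omega> * U n \<omega>)"
    by (rule expectation_draw_mean[OF U_measurable c])
  have "S (Suc n) = expectation (\<lambda>\<omega>. (U n \<omega>)\<^sup>2 + 2 * a\<^sub>m * U n \<omega> + a\<^sub>m\<^sup>2 + 2 * d * (U n \<omega> * real (X (Suc n) \<omega>))
      + 2 * a\<^sub>m * d * real (X (Suc n) \<omega>) + d\<^sup>2 * (real (X (Suc n) \<omega>))\<^sup>2)"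
    unfolding S_def
    by (rule Bochner_Integration.integral_cong) (auto simp: white_step power2_eq_square algebra_simps)
  also have "\<dots> = S n + 2 * a\<^sub>m * M n + a\<^sub>m\<^sup>2 + 2 * d * expectation (\<lambda>\<omega>. U n \<omega> * real (X (Suc n) \<omega>))
      + 2 * a\<^sub>m * d * expectation (\<lambda>\<omega>. real (X (Suc n) \<omega>)) + d\<^sup>2 * expectation (\<lambda>\<omega>. (real (X (Suc n) \<omega>))\<^sup>2)"
    using integrable_U integrable_U2 integrable_X integrable_X2 integrable_UX
    by (simp add: M_def S_def prob_space)
  also have "\<dots> = S n + 2 * a\<^sub>m * M n + a\<^sub>m\<^sup>2 + 2 * d * (real m / T n * S n)
      + 2 * a\<^sub>m * d * (real m / T n * M n) + d\<^sup>2 * (pair_coeff model m (T n) * S n + (real m / T n - same_ball_coeff model m (T n)) * M n)"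
    using X UX unfolding expectation_draw_square
    by (simp add: M_def) (simp add: S_def power2_eq_square)
  finally show ?thesis
    by (simp add: algebra_simps)
qed

lemma urn_beta_eq:
  "urn_beta model m \<sigma> a (W\<^sub>0 + B\<^sub>0) (Suc n)
    = d\<^sup>2 * (real m / T n - same_ball_coeff model m (T n)) + 2 * real m * a\<^sub>m * d / T n + 2 * a\<^sub>m"
  by (cases model) (simp_all add: Let_def same_ball_coeff_def T_def d_def a\<^sub>m_def)

lemma variance_eq: "variance (U n) = S n - (M n)\<^sup>2"
  unfolding S_def M_def by (rule variance_eq[OF integrable_U integrable_U2])

end

section \<open>Variance asymptotics of the urn\<close>

lemma Gamma_quotient_sequence:
  fixes x\<^sub>1 x\<^sub>2 y\<^sub>1 y\<^sub>2 :: real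
  assumes "x\<^sub>1 > 0" "x\<^sub>2 > 0" "y\<^sub>1 > 0" "y\<^sub>2 > 0"
  defines "\<psi> \<equiv> (\<lambda>n. Gamma (real n + x\<^sub>1) * Gamma (real n + x\<^sub>2) / (Gamma (real n + y\<^sub>1) * Gamma (real n + y\<^sub>2)))"
  shows "\<psi> n \<noteq> 0"
    and "\<psi> (Suc n) = (real n + x\<^sub>1) * (real n + x\<^sub>2) / ((real n + y\<^sub>1) * (real n + y\<^sub>2)) * \<psi> n"
    and "(\<lambda>n. \<psi> n - real n powr (x\<^sub>1 + x\<^sub>2 - (y\<^sub>1 + y\<^sub>2))) \<in> O(\<lambda>n. real n powr (x\<^sub>1 + x\<^sub>2 - (y\<^sub>1 + y\<^sub>2) - 1))"
proof -
  have "Gamma (real n + z) \<noteq> 0" if "z > 0" for z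
    using Gamma_real_pos[of "real n + z"] that by (metis add_nonneg_pos less_irrefl of_nat_0_le_iff)
  then show "\<psi> n \<noteq> 0"
    using assms by (simp add: \<psi>_def)
  show "\<psi> (Suc n) = (real n + x\<^sub>1) * (real n + x\<^sub>2) / ((real n + y\<^sub>1) * (real n + y\<^sub>2)) * \<psi> n"
    unfolding \<psi>_def using assms(1-4) by (simp add: Gamma_shift_Suc mult_ac del: of_nat_Suc)
  define f g where "f n = Gamma (real n + x\<^sub>1) / Gamma (real n + y\<^sub>1)" and "g n = Gamma (real n + x\<^sub>2) / Gamma (real n + y\<^sub>2)" for n
  define p q where "p = x\<^sub>1 - y\<^sub>1" and "q = x\<^sub>2 - y\<^sub>2"
  have f: "(\<lambda>n. f n - real n powr p) \<in> O(\<lambda>n. real n powr (p - 1))"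
    and g: "(\<lambda>n. g n - real n powr q) \<in> O(\<lambda>n. real n powr (q - 1))"
    unfolding f_def g_def p_def q_def using assms by (auto intro: Gamma_ratio_asymp)
  have "(\<lambda>n. (f n - real n powr p) * (g n - real n powr q) + (f n - real n powr p) * real n powr q
      + real n powr p * (g n - real n powr q)) \<in> O(\<lambda>n. real n powr (p + q - 1))"
  proof (rule sum_in_bigo(1)[OF sum_in_bigo(1)])
    have "(\<lambda>n. (f n - real n powr p) * (g n - real n powr q)) \<in> O(\<lambda>n. real n powr (p + q - 2))"
      by (rule bigo_powr_mult[OF f g]) simp
    then show "(\<lambda>n. (f n - real n powr p) * (g n - real n powr q)) \<in> O(\<lambda>n. real n powr (p + q - 1))"
      by (rule bigo_powr_mono) simp
    show "(\<lambda>n. (f n - real n powr p) * real n powr q) \<in> O(\<lambda>n. real n powr (p + q - 1))"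
      by (rule bigo_powr_mult[OF f landau_o.big_refl]) simp
    show "(\<lambda>n. real n powr p * (g n - real n powr q)) \<in> O(\<lambda>n. real n powr (p + q - 1))"
      by (rule bigo_powr_mult[OF landau_o.big_refl g]) simp
  qed
  moreover have "(f n - real n powr p) * (g n - real n powr q) + (f n - real n powr p) * real n powr q
      + real n powr p * (g n - real n powr q) = \<psi> n - real n powr (p + q)" for n
    by (simp add: f_def g_def \<psi>_def powr_add algebra_simps)
  moreover have "p + q = x\<^sub>1 + x\<^sub>2 - (y\<^sub>1 + y\<^sub>2)"
    by (simp add: p_def q_def)
  ultimately show "(\<lambda>n. \<psi> n - real n powr (x\<^sub>1 + x\<^sub>2 - (y\<^sub>1 + y\<^sub>2))) \<in> O(\<lambda>n. real n powr (x\<^sub>1 + x\<^sub>2 - (y\<^sub>1 + y\<^sub>2) - 1))"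
    by (simp only:)
qed

context tenable_affine_urn
begin

abbreviation \<Lambda> :: real where "\<Lambda> \<equiv> urn_index m \<sigma> a"

definition t :: real where "t = real (W\<^sub>0 + B\<^sub>0) / real \<sigma>"

definition \<alpha> :: "nat \<Rightarrow> real" where
  "\<alpha> n = 1 + 2 * real m * d / T n + d\<^sup>2 * pair_coeff model m (T n)"

definition K :: real where "K = urn_mean_coeff m \<sigma> a W\<^sub>0 (W\<^sub>0 + B\<^sub>0)"

text \<open>The proportion for which \<open>p * T n\<close> solves the recursion of the mean
  exactly; for \<open>\<Lambda> < 1\<close> it is the limit of \<open>M n / T n\<close>.\<close>

definition p :: real where "p = a\<^sub>m / (real \<sigma> * (1 - \<Lambda>))"

definition V :: "nat \<Rightarrow> real" where "V n = S n - (M n)\<^sup>2"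

lemma \<sigma>_pos: "real \<sigma> > 0"
  using balance_pos by simp

lemma m_pos: "real m > 0"
  using sample_size_pos by simp

lemma index_eq: "real m * d = real \<sigma> * \<Lambda>"
  using \<sigma>_pos by (simp add: urn_index_def d_def)

lemma T_eq: "T n = real \<sigma> * (real n + t)"
  using \<sigma>_pos by (simp add: T_def t_def field_simps)

lemma T_0_pos: "real (W\<^sub>0 + B\<^sub>0) > 0"
  using T_pos[of 0] by (simp add: T_def)

lemma t_pos: "t > 0"
  using T_0_pos \<sigma>_pos by (simp add: t_def)

text \<open>The drift hypothesis divided by \<open>\<sigma>\<close>. It keeps the Gamma quotient of
  the mean away from poles even when the index is negative.\<close>

lemma t_index_pos: "t + \<Lambda> > 0"
proof -
  have "real_of_int (int (W\<^sub>0 + B\<^sub>0) + int m * (a (m - 1) - a m)) > 0"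
    using drift_pos by linarith
  then have "real (W\<^sub>0 + B\<^sub>0) + real m * d > 0"
    by (simp add: d_def urn_diff_def)
  then have "real \<sigma> * (t + \<Lambda>) > 0"
    using \<sigma>_pos by (simp add: index_eq t_def distrib_left del: of_nat_add)
  then show ?thesis
    using \<sigma>_pos by (simp add: zero_less_mult_iff)
qed

text \<open>Equivalently \<open>\<sigma> * (1 - \<Lambda>) = a\<^sub>m + b 0\<close>. Hence
  \<open>p\<close> is the share of \<open>a\<^sub>m\<close> in that sum and \<open>1 - p\<close> the
  share of \<open>b 0\<close>.\<close>

lemma b_0_eq: "real_of_int (b 0) = real \<sigma> * (1 - \<Lambda>) - a\<^sub>m"
proof -
  have "a 0 = int m * a (m - 1) - (int m - 1) * a m" "b 0 = int \<sigma> - a 0"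
    using affine balanced by (auto simp: affine_urn_def balanced_urn_def algebra_simps)
  then have "real_of_int (b 0) = real_of_int (int \<sigma> - (int m * a (m - 1) - (int m - 1) * a m))"
    by simp
  then have "real_of_int (b 0) = real \<sigma> - real m * d - a\<^sub>m"
    by (simp add: d_def urn_diff_def a\<^sub>m_def algebra_simps)
  then show ?thesis
    by (simp add: index_eq algebra_simps)
qed

text \<open>The left side is \<open>d^2\<close> times the variance of a binomial variable with
  \<open>m\<close> trials and success probability \<open>p\<close>, the limit of the inhomogeneity
  in the variance recursion.\<close>

lemma limit_increment_eq:
  assumes "\<Lambda> < 1"
  shows "d\<^sup>2 * real m * p * (1 - p) = \<Lambda>\<^sup>2 * a\<^sub>m * real_of_int (b 0) / (real m * (1 - \<Lambda>)\<^sup>2)"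
proof -
  define s where "s = real \<sigma> * (1 - \<Lambda>)"
  have s: "s > 0" "1 - \<Lambda> > 0"
    using assms \<sigma>_pos by (simp_all add: s_def)
  have d: "d = real \<sigma> * \<Lambda> / real m"
    using index_eq m_pos by (simp add: field_simps)
  have "p * (1 - p) = a\<^sub>m * (s - a\<^sub>m) / s\<^sup>2"
    using s by (simp add: p_def s_def[symmetric] field_simps power2_eq_square)
  moreover have "d\<^sup>2 * real m = real \<sigma> ^ 2 * \<Lambda>\<^sup>2 / real m"
    using m_pos by (simp add: d power2_eq_square)
  ultimately have "d\<^sup>2 * real m * p * (1 - p) = real \<sigma> ^ 2 * \<Lambda>\<^sup>2 / real m * (a\<^sub>m * (s - a\<^sub>m) / s\<^sup>2)"
    by (simp add: mult.assoc)
  then show ?thesis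
    using \<sigma>_pos s(2) by (simp add: b_0_eq s_def power_mult_distrib)
qed

section \<open>Orders of magnitude of the coefficients\<close>

lemma inverse_T_bigo: "(\<lambda>n. inverse (T n)) \<in> O(\<lambda>n. real n powr (-1))"
  unfolding T_def using \<sigma>_pos by real_asymp

text \<open>In both models the scaled coefficient has the limit \<open>m * (m - 1)\<close>, which is
  why the constants for small and critical index do not depend on the model. With replacement the
  error is zero.\<close>

lemma pair_coeff_bigo: "(\<lambda>n. pair_coeff model m (T n) * (T n)\<^sup>2 - (real m)\<^sup>2 + real m) \<in> O(\<lambda>n. real n powr (-1))"
proof (cases model)
  case Without_Replacement
  have "(\<lambda>n. T n / (T n - 1) - 1) \<in> O(\<lambda>n. real n powr (-1))"
    unfolding T_def using \<sigma>_pos by real_asymp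
  then have "(\<lambda>n. real m * (real m - 1) * (T n / (T n - 1) - 1)) \<in> O(\<lambda>n. real n powr (-1))"
    by (rule bigo_cmult)
  moreover have "pair_coeff model m (T n) * (T n)\<^sup>2 - (real m)\<^sup>2 + real m = real m * (real m - 1) * (T n / (T n - 1) - 1)" for n
  proof -
    have "c / (T n * (T n - 1)) * (T n)\<^sup>2 = c * (T n / (T n - 1))" for c
      using T_pos[of n] by (simp add: power2_eq_square)
    then have "pair_coeff model m (T n) * (T n)\<^sup>2 = real m * (real m - 1) * (T n / (T n - 1))"
      by (simp only: Without_Replacement pair_coeff_def drawing_model.case)
    then show ?thesis
      by (simp only: right_diff_distrib) (simp add: power2_eq_square)
  qed
  ultimately show ?thesis
    by (simp only:)
next
  case With_Replacement
  have "pair_coeff model m (T n) * (T n)\<^sup>2 - (real m)\<^sup>2 + real m = 0" for n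
  proof -
    have "pair_coeff model m (T n) * (T n)\<^sup>2 = real m * (real m - 1)"
      using T_pos[of n] by (simp add: With_Replacement pair_coeff_def)
    then show ?thesis
      by (simp add: power2_eq_square algebra_simps)
  qed
  then show ?thesis
    by simp
qed

lemma same_ball_coeff_bigo: "(\<lambda>n. same_ball_coeff model m (T n)) \<in> O(\<lambda>n. real n powr (-2))"
proof (cases model)
  case Without_Replacement
  have "(\<lambda>n. 1 / (T n * (T n - 1))) \<in> O(\<lambda>n. real n powr (-2))"
    unfolding T_def using \<sigma>_pos by real_asymp
  then have "(\<lambda>n. real m * (real m - 1) * (1 / (T n * (T n - 1)))) \<in> O(\<lambda>n. real n powr (-2))"
    by (rule bigo_cmult)
  then show ?thesis
    by (simp add: Without_Replacement same_ball_coeff_def del: landau_o.big.cmult_in_iff)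
qed (simp add: same_ball_coeff_def)

lemma T_bigo: "T \<in> O(\<lambda>n. real n powr 1)"
  unfolding T_def using \<sigma>_pos by real_asymp

lemma growth_rate: "(\<lambda>n. real n * (\<alpha> n - 1)) \<longlonglongrightarrow> 2 * \<Lambda>"
proof -
  have "(\<lambda>n. real n / T n) \<longlonglongrightarrow> inverse (real \<sigma>)"
    unfolding T_def using \<sigma>_pos by real_asymp
  moreover have "(\<lambda>n. real n * pair_coeff model m (T n)) \<longlonglongrightarrow> 0"
    unfolding T_def pair_coeff_def using \<sigma>_pos by (cases model; simp; real_asymp)
  ultimately have "(\<lambda>n. 2 * real m * d * (real n / T n) + d\<^sup>2 * (real n * pair_coeff model m (T n)))
      \<longlonglongrightarrow> 2 * real m * d * inverse (real \<sigma>) + d\<^sup>2 * 0"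
    by (intro tendsto_add tendsto_mult[OF tendsto_const])
  moreover have "2 * real m * d * inverse (real \<sigma>) + d\<^sup>2 * 0 = 2 * \<Lambda>"
    using index_eq \<sigma>_pos by (simp add: field_simps)
  moreover have "2 * real m * d * (real n / T n) + d\<^sup>2 * (real n * pair_coeff model m (T n)) = real n * (\<alpha> n - 1)" for n
    by (simp add: \<alpha>_def algebra_simps)
  ultimately show ?thesis
    by (simp only:)
qed

section \<open>Variance recursion and asymptotics of the mean\<close>

lemma S_Suc': "S (Suc n) = \<alpha> n * S n + (urn_beta model m \<sigma> a (W\<^sub>0 + B\<^sub>0) (Suc n) * M n + a\<^sub>m\<^sup>2)"
  unfolding S_Suc urn_beta_eq \<alpha>_def by simp

text \<open>All terms with \<open>a\<^sub>m\<close> cancel. What remains besides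
  \<open>\<alpha> n * V n\<close> is \<open>d^2\<close> times the conditional variance of the sample
  count, evaluated as if the white count were equal to its mean.\<close>

lemma V_Suc:
  "V (Suc n) = \<alpha> n * V n + d\<^sup>2 * ((M n / T n)\<^sup>2 * (pair_coeff model m (T n) * (T n)\<^sup>2 - (real m)\<^sup>2)
     + M n / T n * (real m - same_ball_coeff model m (T n) * T n))"
proof -
  define x where "x = M n / T n"
  have M: "M n = x * T n"
    using T_pos[of n] by (simp add: x_def)
  have 1: "M (Suc n) = M n + real m * d * x + a\<^sub>m"
    by (simp add: M_Suc x_def distrib_right)
  have 2: "S (Suc n) = \<alpha> n * S n + d\<^sup>2 * (real m * x - same_ball_coeff model m (T n) * M n) + 2 * real m * a\<^sub>m * d * x + 2 * a\<^sub>m * M n + a\<^sub>m\<^sup>2"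
    unfolding S_Suc' urn_beta_eq by (simp add: x_def algebra_simps)
  have 3: "\<alpha> n * (M n)\<^sup>2 = (M n)\<^sup>2 + 2 * real m * d * x * M n + d\<^sup>2 * pair_coeff model m (T n) * (M n)\<^sup>2"
    by (simp add: \<alpha>_def x_def power2_eq_square algebra_simps)
  have "V (Suc n) = \<alpha> n * V n + (\<alpha> n * (M n)\<^sup>2 + d\<^sup>2 * (real m * x - same_ball_coeff model m (T n) * M n) + 2 * real m * a\<^sub>m * d * x + 2 * a\<^sub>m * M n + a\<^sub>m\<^sup>2
      - (M n + real m * d * x + a\<^sub>m)\<^sup>2)"
    unfolding V_def 1 2 by (simp add: algebra_simps)
  also have "\<dots> = \<alpha> n * V n + d\<^sup>2 * (x\<^sup>2 * (pair_coeff model m (T n) * (T n)\<^sup>2 - (real m)\<^sup>2)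
     + x * (real m - same_ball_coeff model m (T n) * T n))"
    unfolding 3 unfolding M by (simp add: power2_eq_square algebra_simps)
  finally show ?thesis
    by (simp only: x_def)
qed

text \<open>Since \<open>p * T n\<close> is a particular solution, the deviation obeys the
  homogeneous recursion with factor \<open>(n + t + \<Lambda>) / (n + t)\<close>, whose solutions
  are multiples of a Gamma quotient; \<open>K\<close> is fixed by \<open>n = 0\<close>.\<close>

lemma mean_deviation:
  assumes "\<Lambda> < 1"
  shows "M n - p * T n = K * (Gamma (real n + (t + \<Lambda>)) / Gamma (real n + t))"
proof (induction n)
  case 0
  have "Gamma t \<noteq> 0" "Gamma (t + \<Lambda>) \<noteq> 0"
    using t_pos t_index_pos by (metis Gamma_real_pos less_irrefl)+
  then have "K * (Gamma (t + \<Lambda>) / Gamma t) = real W\<^sub>0 - (a\<^sub>m * real (W\<^sub>0 + B\<^sub>0) / real \<sigma>) / (1 - \<Lambda>)"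
    by (simp add: K_def urn_mean_coeff_def Let_def a\<^sub>m_def t_def del: of_nat_add)
  then show ?case
    by (simp add: M_0 T_def p_def)
next
  case (Suc n)
  have "p * (real \<sigma> * (1 - \<Lambda>)) = a\<^sub>m"
    using assms \<sigma>_pos by (simp add: p_def)
  then have "p * real \<sigma> = p * (real m * d) + a\<^sub>m"
    by (simp add: index_eq algebra_simps)
  moreover have "T (Suc n) = T n + real \<sigma>"
    by (simp add: T_def algebra_simps)
  ultimately have "M (Suc n) - p * T (Suc n) = (1 + real m * d / T n) * (M n - p * T n)"
    using T_pos[of n] by (simp add: M_Suc field_simps)
  also have "1 + real m * d / T n = (real n + (t + \<Lambda>)) / (real n + t)"
  proof -
    have "real n + t \<noteq> 0"
      using t_pos by linarith
    moreover have "real m * d / T n = \<Lambda> / (real n + t)"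
      unfolding index_eq T_eq using \<sigma>_pos by (intro mult_divide_mult_cancel_left) simp
    ultimately show ?thesis
      by (simp add: field_simps)
  qed
  finally show ?case
    unfolding Suc Gamma_shift_Suc[OF t_pos] Gamma_shift_Suc[OF t_index_pos] by simp
qed

lemma mean_deviation_asymp:
  assumes "\<Lambda> < 1"
  shows "(\<lambda>n. M n - p * T n - K * real n powr \<Lambda>) \<in> O(\<lambda>n. real n powr (\<Lambda> - 1))"
proof -
  have "(\<lambda>n. Gamma (real n + (t + \<Lambda>)) / Gamma (real n + t) - real n powr \<Lambda>) \<in> O(\<lambda>n. real n powr (\<Lambda> - 1))"
    using Gamma_ratio_asymp[OF t_index_pos t_pos] by simp
  then have "(\<lambda>n. K * (Gamma (real n + (t + \<Lambda>)) / Gamma (real n + t) - real n powr \<Lambda>)) \<in> O(\<lambda>n. real n powr (\<Lambda> - 1))"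
    by (rule bigo_cmult)
  then show ?thesis
    unfolding mean_deviation[OF assms] by (simp add: right_diff_distrib)
qed

lemma mean_asymp:
  assumes "0 < \<Lambda>" "\<Lambda> < 1"
  shows "(\<lambda>n. M n - (a\<^sub>m / (1 - \<Lambda>) * real n + K * real n powr \<Lambda>)) \<in> O(\<lambda>n. real n powr 0)"
proof -
  have "(\<lambda>n. M n - p * T n - K * real n powr \<Lambda>) \<in> O(\<lambda>n. real n powr 0)"
    by (rule bigo_powr_mono[OF mean_deviation_asymp]) (use assms in auto)
  \<comment> \<open>The initial total contributes only a constant to \<open>p * T n\<close>, and
    this constant joins the error.\<close>
  then have "(\<lambda>n. (M n - p * T n - K * real n powr \<Lambda>) + p * real (W\<^sub>0 + B\<^sub>0)) \<in> O(\<lambda>n. real n powr 0)"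
    using const_bigo_powr by (rule sum_in_bigo(1))
  moreover have "a\<^sub>m / (1 - \<Lambda>) = p * real \<sigma>"
    using \<sigma>_pos by (simp add: p_def)
  ultimately show ?thesis
    by (simp add: T_def algebra_simps del: of_nat_add)
qed

lemma proportion_asymp:
  assumes "\<Lambda> < 1"
  shows "(\<lambda>n. M n / T n - p) \<in> O(\<lambda>n. real n powr (\<Lambda> - 1))"
proof -
  have "(\<lambda>n. M n - p * T n - K * real n powr \<Lambda>) \<in> O(\<lambda>n. real n powr \<Lambda>)"
    by (rule bigo_powr_mono[OF mean_deviation_asymp[OF assms]]) simp
  moreover have "(\<lambda>n. K * real n powr \<Lambda>) \<in> O(\<lambda>n. real n powr \<Lambda>)"
    by (rule bigo_cmult) simp
  ultimately have "(\<lambda>n. M n - p * T n - K * real n powr \<Lambda> + K * real n powr \<Lambda>) \<in> O(\<lambda>n. real n powr \<Lambda>)"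
    by (rule sum_in_bigo(1))
  then have "(\<lambda>n. (M n - p * T n) * inverse (T n)) \<in> O(\<lambda>n. real n powr (\<Lambda> - 1))"
    by (intro bigo_powr_mult[OF _ inverse_T_bigo]) auto
  moreover have "(M n - p * T n) * inverse (T n) = M n / T n - p" for n
    using T_pos[of n] by (simp add: field_simps)
  ultimately show ?thesis
    by simp
qed

text \<open>The dominant error is that of the proportion, of order n^(\<Lambda> - 1) and thus at
  most n^(-1/2); the coefficients contribute only 1/n. In the critical case this rate is still
  summable after division by \<open>n\<close>.\<close>

lemma conditional_variance_asymp:
  assumes "\<Lambda> \<le> 1/2"
  shows "(\<lambda>n. d\<^sup>2 * ((M n / T n)\<^sup>2 * (pair_coeff model m (T n) * (T n)\<^sup>2 - (real m)\<^sup>2)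
     + M n / T n * (real m - same_ball_coeff model m (T n) * T n)) - d\<^sup>2 * real m * p * (1 - p)) \<in> O(\<lambda>n. real n powr (-1/2))"
proof -
  define x where "x n = M n / T n" for n
  define u where "u n = pair_coeff model m (T n) * (T n)\<^sup>2 - (real m)\<^sup>2 + real m" for n
  define v where "v n = same_ball_coeff model m (T n) * T n" for n
  have xp: "(\<lambda>n. x n - p) \<in> O(\<lambda>n. real n powr (-1/2))"
    unfolding x_def by (rule bigo_powr_mono[OF proportion_asymp]) (use assms in auto)
  have x: "x \<in> O(\<lambda>n. real n powr 0)"
  proof -
    have "(\<lambda>n. (x n - p) + p) \<in> O(\<lambda>n. real n powr 0)"
      by (rule sum_in_bigo(1)[OF bigo_powr_mono[OF xp] const_bigo_powr]) simp
    then show ?thesis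
      by simp
  qed
  have u: "u \<in> O(\<lambda>n. real n powr (-1/2))"
    unfolding u_def by (rule bigo_powr_mono[OF pair_coeff_bigo]) simp
  have v: "v \<in> O(\<lambda>n. real n powr (-1/2))"
    unfolding v_def by (rule bigo_powr_mono[OF bigo_powr_mult[OF same_ball_coeff_bigo T_bigo refl]]) simp
  \<comment> \<open>The last summand is \<open>m\<close> times the difference of
    \<open>x * (1 - x)\<close> and \<open>p * (1 - p)\<close>, with the factor \<open>x - p\<close>
    split off.\<close>
  have "(\<lambda>n. (x n * x n) * u n - x n * v n + (x n - p) * (real m * (1 - p - x n))) \<in> O(\<lambda>n. real n powr (-1/2))"
  proof (rule sum_in_bigo(1)[OF sum_in_bigo(2)])
    show "(\<lambda>n. (x n * x n) * u n) \<in> O(\<lambda>n. real n powr (-1/2))"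
      by (rule bigo_powr_mult[OF bigo_powr_mult[OF x x refl] u]) simp
    show "(\<lambda>n. x n * v n) \<in> O(\<lambda>n. real n powr (-1/2))"
      by (rule bigo_powr_mult[OF x v]) simp
    have "(\<lambda>n. real m * (1 - p - x n)) \<in> O(\<lambda>n. real n powr 0)"
      by (rule bigo_cmult[OF sum_in_bigo(2)[OF const_bigo_powr x]])
    then show "(\<lambda>n. (x n - p) * (real m * (1 - p - x n))) \<in> O(\<lambda>n. real n powr (-1/2))"
      by (rule bigo_powr_mult[OF xp]) simp
  qed
  then have "(\<lambda>n. d\<^sup>2 * ((x n * x n) * u n - x n * v n + (x n - p) * (real m * (1 - p - x n)))) \<in> O(\<lambda>n. real n powr (-1/2))"
    by (rule bigo_cmult)
  moreover have "d\<^sup>2 * ((x n * x n) * u n - x n * v n + (x n - p) * (real m * (1 - p - x n)))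
      = d\<^sup>2 * ((x n)\<^sup>2 * (pair_coeff model m (T n) * (T n)\<^sup>2 - (real m)\<^sup>2) + x n * (real m - same_ball_coeff model m (T n) * T n))
        - d\<^sup>2 * real m * p * (1 - p)" for n
    unfolding u_def v_def by (simp add: power2_eq_square algebra_simps)
  ultimately show ?thesis
    unfolding x_def by (simp only:)
qed

section \<open>The three ranges of the index\<close>

lemma variance_small_index:
  assumes "\<Lambda> < 1/2"
  shows "(\<lambda>n. V n - \<Lambda>\<^sup>2 * a\<^sub>m * real_of_int (b 0) / (real m * (1 - \<Lambda>)\<^sup>2) / (1 - 2 * \<Lambda>) * real n) \<in> o(\<lambda>n. real n)"
proof -
  define r where "r n = d\<^sup>2 * ((M n / T n)\<^sup>2 * (pair_coeff model m (T n) * (T n)\<^sup>2 - (real m)\<^sup>2)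
     + M n / T n * (real m - same_ball_coeff model m (T n) * T n))" for n
  define \<rho> where "\<rho> = d\<^sup>2 * real m * p * (1 - p)"
  have "(\<lambda>n. r n - \<rho>) \<in> O(\<lambda>n. real n powr (-1/2))"
    unfolding r_def \<rho>_def by (rule conditional_variance_asymp) (use assms in simp)
  also have "(\<lambda>n. real n powr (-1/2)) \<in> o(\<lambda>_. 1)"
    by real_asymp
  finally have "(\<lambda>n. r n - \<rho>) \<longlonglongrightarrow> 0"
    by (rule smalloD_tendsto[where g = "\<lambda>_. 1", simplified])
  then have "r \<longlonglongrightarrow> \<rho>"
    by (simp add: LIM_zero_iff)
  then have "(\<lambda>n. V n - \<rho> / (1 - 2 * \<Lambda>) * real n) \<in> o(\<lambda>n. real n)"
    by (intro linear_recursion_subcritical[of V \<alpha> r] growth_rate) (use assms in \<open>simp_all add: V_Suc r_def\<close>)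
  then show ?thesis
    using limit_increment_eq assms by (simp add: \<rho>_def)
qed

lemma urn_beta_asymp: "(\<lambda>n. urn_beta model m \<sigma> a (W\<^sub>0 + B\<^sub>0) (Suc n) - 2 * a\<^sub>m) \<in> O(\<lambda>n. real n powr (-1))"
proof -
  have "(\<lambda>n. (d\<^sup>2 * real m + 2 * real m * a\<^sub>m * d) * inverse (T n) - d\<^sup>2 * same_ball_coeff model m (T n)) \<in> O(\<lambda>n. real n powr (-1))"
    by (intro sum_in_bigo(2) bigo_cmult inverse_T_bigo bigo_powr_mono[OF same_ball_coeff_bigo]) simp
  moreover have "(d\<^sup>2 * real m + 2 * real m * a\<^sub>m * d) * inverse (T n) - d\<^sup>2 * same_ball_coeff model m (T n)
      = urn_beta model m \<sigma> a (W\<^sub>0 + B\<^sub>0) (Suc n) - 2 * a\<^sub>m" for n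
    unfolding urn_beta_eq by (simp add: divide_inverse algebra_simps)
  ultimately show ?thesis
    by (simp only:)
qed

text \<open>Clears denominators, so that matching \<open>\<alpha>\<close> with the growth factor of
  a Gamma quotient becomes two polynomial identities. \<open>q\<close> is the denominator of
  \<open>\<alpha> n\<close>, up to an auxiliary factor.\<close>

lemma growth_factor_eq:
  assumes "y\<^sub>1 > 0" "y\<^sub>2 > 0"
    and T: "real \<sigma> * (real n + y\<^sub>1) * (real \<sigma> * (real n + y\<^sub>2)) = q"
    and "real \<sigma> * (real n + x\<^sub>1) * (real \<sigma> * (real n + x\<^sub>2)) = q * \<alpha> n"
  shows "(real n + x\<^sub>1) * (real n + x\<^sub>2) / ((real n + y\<^sub>1) * (real n + y\<^sub>2)) = \<alpha> n"
proof -
  have "q > 0"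
    unfolding T[symmetric] using assms(1,2) \<sigma>_pos by (intro mult_pos_pos) auto
  have "(real n + x\<^sub>1) * (real n + x\<^sub>2) / ((real n + y\<^sub>1) * (real n + y\<^sub>2))
    = (real \<sigma> * real \<sigma> * ((real n + x\<^sub>1) * (real n + x\<^sub>2))) / (real \<sigma> * real \<sigma> * ((real n + y\<^sub>1) * (real n + y\<^sub>2)))"
    using \<sigma>_pos by simp
  also have "\<dots> = q * \<alpha> n / q"
    unfolding assms(4)[symmetric] by (simp add: T[symmetric] mult_ac)
  finally show ?thesis
    using \<open>q > 0\<close> by simp
qed

text \<open>The parameters in \<open>urn_psi\<close> come from factoring the numerator of
  \<open>\<alpha> n\<close>: it is \<open>(T n + m * d)^2 - m * d^2\<close> with replacement, and
  \<open>(T n + m * d - 1/2)^2\<close> minus a quarter of the radicand without. Positivity of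
  \<open>d\<close> makes all four parameters positive, which excludes zeros and poles.\<close>

lemma urn_psi_properties:
  assumes d: "d > 0"
  defines "\<psi> \<equiv> urn_psi model m \<sigma> a (W\<^sub>0 + B\<^sub>0)"
  shows "\<psi> n \<noteq> 0" and "\<psi> (Suc n) = \<alpha> n * \<psi> n"
    and "(\<lambda>n. \<psi> n - real n powr (2 * \<Lambda>)) \<in> O(\<lambda>n. real n powr (2 * \<Lambda> - 1))"
proof -
  define \<tau> where "\<tau> = real (W\<^sub>0 + B\<^sub>0)"
  have \<tau>: "\<tau> > 0" "\<tau> \<ge> real m"
    using T_0_pos sample_size_le by (simp_all add: \<tau>_def)
  have T: "T n = real \<sigma> * real n + \<tau>" for n
    by (simp add: T_def \<tau>_def)
  have "\<exists>x\<^sub>1 x\<^sub>2 y\<^sub>1 y\<^sub>2. x\<^sub>1 > 0 \<and> x\<^sub>2 > 0 \<and> y\<^sub>1 > 0 \<and> y\<^sub>2 > 0 \<and> x\<^sub>1 + x\<^sub>2 - (y\<^sub>1 + y\<^sub>2) = 2 * \<Lambda> \<and>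
      (\<forall>n. (real n + x\<^sub>1) * (real n + x\<^sub>2) / ((real n + y\<^sub>1) * (real n + y\<^sub>2)) = \<alpha> n) \<and>
      \<psi> = (\<lambda>n. Gamma (real n + x\<^sub>1) * Gamma (real n + x\<^sub>2) / (Gamma (real n + y\<^sub>1) * Gamma (real n + y\<^sub>2)))"
  proof (cases model)
    case With_Replacement
    define s where "s = sqrt (real m)"
    have s: "s * s = real m" "s \<le> real m" "s \<ge> 0"
      using sample_size_pos real_sqrt_le_iff[of "real m" "(real m)\<^sup>2"]
      by (simp_all add: s_def power2_eq_square)
    define x\<^sub>1 x\<^sub>2 where "x\<^sub>1 = (real m * d + \<tau> + d * s) / real \<sigma>" and "x\<^sub>2 = (real m * d + \<tau> - d * s) / real \<sigma>"
    have "d * s \<le> real m * d" "d * s \<ge> 0" "real m * d \<ge> 0"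
      using s d by (simp_all add: mult.commute)
    then have "real m * d + \<tau> + d * s > 0" "real m * d + \<tau> - d * s > 0"
      using \<tau>(1) by linarith+
    then have pos: "x\<^sub>1 > 0" "x\<^sub>2 > 0" "\<tau> / real \<sigma> > 0"
      using \<tau>(1) \<sigma>_pos by (simp_all add: x\<^sub>1_def x\<^sub>2_def)
    have \<sigma>_mult: "real \<sigma> * x\<^sub>1 = real m * d + \<tau> + d * s" "real \<sigma> * x\<^sub>2 = real m * d + \<tau> - d * s" "real \<sigma> * (\<tau> / real \<sigma>) = \<tau>"
      using \<sigma>_pos by (simp_all add: x\<^sub>1_def x\<^sub>2_def)
    have "real \<sigma> * (x\<^sub>1 + x\<^sub>2 - (\<tau> / real \<sigma> + \<tau> / real \<sigma>)) = 2 * (real \<sigma> * \<Lambda>)"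
      unfolding right_diff_distrib distrib_left \<sigma>_mult index_eq[symmetric] by simp
    then have sum: "x\<^sub>1 + x\<^sub>2 - (\<tau> / real \<sigma> + \<tau> / real \<sigma>) = 2 * \<Lambda>"
      using \<sigma>_pos by simp
    have "(real n + x\<^sub>1) * (real n + x\<^sub>2) / ((real n + \<tau> / real \<sigma>) * (real n + \<tau> / real \<sigma>)) = \<alpha> n" for n
    proof (rule growth_factor_eq[OF pos(3,3)])
      show "real \<sigma> * (real n + \<tau> / real \<sigma>) * (real \<sigma> * (real n + \<tau> / real \<sigma>)) = T n * T n"
        unfolding distrib_left \<sigma>_mult T ..
      have "pair_coeff model m (T n) = real m * (real m - 1) / (T n * T n)"
        by (simp add: With_Replacement pair_coeff_def power2_eq_square)
      then have "T n * T n * \<alpha> n = T n * T n + 2 * real m * d * T n + d\<^sup>2 * (real m * (real m - 1))"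
        using T_pos[of n] by (simp add: \<alpha>_def distrib_left)
      also have "real m * (real m - 1) = real m * real m - s * s"
        by (simp add: s right_diff_distrib)
      finally show "real \<sigma> * (real n + x\<^sub>1) * (real \<sigma> * (real n + x\<^sub>2)) = T n * T n * \<alpha> n"
        unfolding distrib_left \<sigma>_mult T by (simp add: power2_eq_square algebra_simps)
    qed
    moreover have "\<psi> = (\<lambda>n. Gamma (real n + x\<^sub>1) * Gamma (real n + x\<^sub>2) / (Gamma (real n + \<tau> / real \<sigma>) * Gamma (real n + \<tau> / real \<sigma>)))"
      unfolding \<psi>_def With_Replacement
      by (simp add: fun_eq_iff Let_def x\<^sub>1_def x\<^sub>2_def \<tau>_def d_def s_def power2_eq_square)
    ultimately show ?thesis
      using pos sum by blast
  next
    case Without_Replacement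
    show ?thesis
    proof (cases "m = 1")
      case True
      \<comment> \<open>Here \<open>urn_psi\<close> is a single quotient; the second one is taken to be trivial.\<close>
      define x where "x = (2 * d + \<tau>) / real \<sigma>"
      have pos: "x > 0" "\<tau> / real \<sigma> > 0"
        using d \<tau> \<sigma>_pos by (simp_all add: x_def)
      have "x + 1 - (\<tau> / real \<sigma> + 1) = 2 * \<Lambda>"
        using \<sigma>_pos index_eq True by (simp add: x_def field_simps)
      moreover have "(real n + x) * (real n + 1) / ((real n + \<tau> / real \<sigma>) * (real n + 1)) = \<alpha> n" for n
      proof (rule growth_factor_eq)
        have "real m = 1" "pair_coeff model m (T n) = 0"
          using True by (simp_all add: Without_Replacement pair_coeff_def)
        then have "T n * \<alpha> n = T n + 2 * d"
          unfolding \<alpha>_def using T_pos[of n] by (simp only:) (simp add: distrib_left)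
        also have "\<dots> = real \<sigma> * (real n + x)"
          using \<sigma>_pos by (simp add: T x_def field_simps)
        finally show "real \<sigma> * (real n + x) * (real \<sigma> * (real n + 1)) = T n * (real \<sigma> * (real n + 1)) * \<alpha> n"
          by (simp add: mult_ac)
        show "real \<sigma> * (real n + \<tau> / real \<sigma>) * (real \<sigma> * (real n + 1)) = T n * (real \<sigma> * (real n + 1))"
          using \<sigma>_pos by (simp add: T field_simps)
      qed (use pos in auto)
      moreover have "\<psi> = (\<lambda>n. Gamma (real n + x) * Gamma (real n + 1) / (Gamma (real n + \<tau> / real \<sigma>) * Gamma (real n + 1)))"
      proof
        fix n
        have "Gamma (real n + 1) \<noteq> 0"
          using Gamma_real_pos[of "real n + 1"] by linarith
        then show "\<psi> n = Gamma (real n + x) * Gamma (real n + 1) / (Gamma (real n + \<tau> / real \<sigma>) * Gamma (real n + 1))"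
          unfolding \<psi>_def Without_Replacement x_def \<tau>_def d_def
          using True by (simp add: Let_def)
      qed
      ultimately show ?thesis
        using pos by (intro exI[of _ x] exI[of _ 1] exI[of _ "\<tau> / real \<sigma>"]) simp
    next
      case False
      then have m: "real m \<ge> 2"
        using sample_size_pos by simp
      define \<Delta> where "\<Delta> = 1 + 4 * real m * d * (d + 1)"
      define s where "s = sqrt \<Delta>"
      have "\<Delta> \<ge> 0"
        using d unfolding \<Delta>_def by simp
      then have s: "s * s = \<Delta>" "s \<ge> 0"
        by (simp_all add: s_def)
      define c where "c = real m * d + \<tau> - 1/2"
      have c: "c > 0"
        using mult_pos_pos[OF m_pos d] \<tau>(2) m unfolding c_def by linarith
      \<comment> \<open>Positivity of the smaller parameter amounts to
        \<open>\<Delta> < (2 * c)^2\<close>; the difference is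
        \<open>4 * \<tau> * (\<tau> - 1) * \<alpha> 0\<close>.\<close>
      have "(2 * c)\<^sup>2 - \<Delta> = 4 * (\<tau> * (\<tau> - 1) + 2 * real m * d * (\<tau> - 1) + real m * (real m - 1) * d\<^sup>2)"
        by (simp add: c_def \<Delta>_def power2_eq_square algebra_simps)
      also have "\<dots> > 0"
        using d \<tau> m by (intro mult_pos_pos add_pos_nonneg) auto
      finally have "s\<^sup>2 < (2 * c)\<^sup>2"
        by (simp add: power2_eq_square s)
      then have "s < 2 * c"
        by (rule power_less_imp_less_base) (use c in simp)
      define x\<^sub>1 x\<^sub>2 where "x\<^sub>1 = (c + 1/2 * s) / real \<sigma>" and "x\<^sub>2 = (c - 1/2 * s) / real \<sigma>"
      have pos: "x\<^sub>1 > 0" "x\<^sub>2 > 0" "\<tau> / real \<sigma> > 0" "(\<tau> - 1) / real \<sigma> > 0"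
        using s c \<open>s < 2 * c\<close> \<tau> m \<sigma>_pos unfolding x\<^sub>1_def x\<^sub>2_def by auto
      have \<sigma>_mult: "real \<sigma> * x\<^sub>1 = c + 1/2 * s" "real \<sigma> * x\<^sub>2 = c - 1/2 * s"
        "real \<sigma> * (\<tau> / real \<sigma>) = \<tau>" "real \<sigma> * ((\<tau> - 1) / real \<sigma>) = \<tau> - 1"
        using \<sigma>_pos by (simp_all add: x\<^sub>1_def x\<^sub>2_def)
      have "real \<sigma> * (x\<^sub>1 + x\<^sub>2 - (\<tau> / real \<sigma> + (\<tau> - 1) / real \<sigma>)) = 2 * (real \<sigma> * \<Lambda>)"
        unfolding right_diff_distrib distrib_left \<sigma>_mult index_eq[symmetric] by (simp add: c_def)
      then have sum: "x\<^sub>1 + x\<^sub>2 - (\<tau> / real \<sigma> + (\<tau> - 1) / real \<sigma>) = 2 * \<Lambda>"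
        using \<sigma>_pos by simp
      have "(real n + x\<^sub>1) * (real n + x\<^sub>2) / ((real n + \<tau> / real \<sigma>) * (real n + (\<tau> - 1) / real \<sigma>)) = \<alpha> n" for n
      proof (rule growth_factor_eq[OF pos(3,4)])
        show "real \<sigma> * (real n + \<tau> / real \<sigma>) * (real \<sigma> * (real n + (\<tau> - 1) / real \<sigma>)) = T n * (T n - 1)"
          unfolding distrib_left \<sigma>_mult T by (simp add: algebra_simps)
        have "T n - 1 \<noteq> 0"
          using T_ge[of n] m by linarith
        moreover have "pair_coeff model m (T n) = real m * (real m - 1) / (T n * (T n - 1))"
          by (simp add: Without_Replacement pair_coeff_def)
        ultimately have "T n * (T n - 1) * \<alpha> n = T n * (T n - 1) + 2 * real m * d * (T n - 1) + d\<^sup>2 * (real m * (real m - 1))"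
          using T_pos[of n]
          by (simp add: \<alpha>_def distrib_left)
        moreover have "real \<sigma> * (real n + x\<^sub>1) * (real \<sigma> * (real n + x\<^sub>2))
          = (real \<sigma> * real n + c) * (real \<sigma> * real n + c) - s * s / 4"
          unfolding distrib_left \<sigma>_mult by (simp add: algebra_simps)
        ultimately show "real \<sigma> * (real n + x\<^sub>1) * (real \<sigma> * (real n + x\<^sub>2)) = T n * (T n - 1) * \<alpha> n"
          unfolding s by (simp add: T c_def \<Delta>_def power2_eq_square field_simps)
      qed
      moreover have "\<psi> = (\<lambda>n. Gamma (real n + x\<^sub>1) * Gamma (real n + x\<^sub>2) / (Gamma (real n + \<tau> / real \<sigma>) * Gamma (real n + (\<tau> - 1) / real \<sigma>)))"
        unfolding \<psi>_def Without_Replacement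
        using False by (simp add: fun_eq_iff Let_def x\<^sub>1_def x\<^sub>2_def \<tau>_def d_def s_def c_def \<Delta>_def)
      ultimately show ?thesis
        using pos sum by blast
    qed
  qed
  then obtain x\<^sub>1 x\<^sub>2 y\<^sub>1 y\<^sub>2 where pos: "x\<^sub>1 > 0" "x\<^sub>2 > 0" "y\<^sub>1 > 0" "y\<^sub>2 > 0" and sum: "x\<^sub>1 + x\<^sub>2 - (y\<^sub>1 + y\<^sub>2) = 2 * \<Lambda>"
    and \<alpha>: "\<And>n. (real n + x\<^sub>1) * (real n + x\<^sub>2) / ((real n + y\<^sub>1) * (real n + y\<^sub>2)) = \<alpha> n"
    and \<psi>: "\<psi> = (\<lambda>n. Gamma (real n + x\<^sub>1) * Gamma (real n + x\<^sub>2) / (Gamma (real n + y\<^sub>1) * Gamma (real n + y\<^sub>2)))"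
    by auto
  show "\<psi> n \<noteq> 0" "\<psi> (Suc n) = \<alpha> n * \<psi> n"
    "(\<lambda>n. \<psi> n - real n powr (2 * \<Lambda>)) \<in> O(\<lambda>n. real n powr (2 * \<Lambda> - 1))"
    using Gamma_quotient_sequence[OF pos] unfolding \<alpha> \<psi> sum by blast+
qed

lemma diff_pos_iff: "d > 0 \<longleftrightarrow> \<Lambda> > 0"
  using index_eq m_pos \<sigma>_pos by (metis zero_less_mult_pos mult_pos_pos)

lemma variance_critical_index:
  assumes "\<Lambda> = 1/2"
  shows "(\<lambda>n. V n - a\<^sub>m * real_of_int (b 0) / real m * (real n * ln (real n))) \<in> O(\<lambda>n. real n)"
proof -
  define r where "r n = d\<^sup>2 * ((M n / T n)\<^sup>2 * (pair_coeff model m (T n) * (T n)\<^sup>2 - (real m)\<^sup>2)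
     + M n / T n * (real m - same_ball_coeff model m (T n) * T n))" for n
  have "d > 0"
    using diff_pos_iff assms by simp
  note \<psi> = urn_psi_properties[OF this]
  have "(\<lambda>n. V n - d\<^sup>2 * real m * p * (1 - p) * (real n * ln (real n))) \<in> O(\<lambda>n. real n)"
  proof (rule linear_recursion_critical[of V \<alpha> r, OF _ \<psi>(2) \<psi>(1)])
    show "V (Suc n) = \<alpha> n * V n + r n" for n
      by (simp only: V_Suc r_def)
    show "(\<lambda>n. urn_psi model m \<sigma> a (W\<^sub>0 + B\<^sub>0) n - real n powr 1) \<in> O(\<lambda>n. real n powr 0)"
      using \<psi>(3) assms by simp
    show "(\<lambda>n. r n - d\<^sup>2 * real m * p * (1 - p)) \<in> O(\<lambda>n. real n powr (-1/2))"
      unfolding r_def by (rule conditional_variance_asymp) (use assms in simp)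
  qed
  \<comment> \<open>At the critical index \<open>\<Lambda>\<close> equals
    \<open>1 - \<Lambda>\<close>, so the quotient of their squares drops out of the
    constant.\<close>
  also have "d\<^sup>2 * real m * p * (1 - p) = a\<^sub>m * real_of_int (b 0) / real m"
    using limit_increment_eq assms by (simp add: power2_eq_square)
  finally show ?thesis .
qed

lemma variance_large_index:
  assumes "1/2 < \<Lambda>" "\<Lambda> < 1"
  shows "summable (\<lambda>j. large_index_summand model m \<sigma> a W\<^sub>0 (W\<^sub>0 + B\<^sub>0) M (Suc j))"
    and "(\<lambda>n. V n - large_index_constant model m \<sigma> a W\<^sub>0 (W\<^sub>0 + B\<^sub>0) M * real n powr (2 * \<Lambda>)) \<in> O(\<lambda>n. real n)"
proof -
  have "d > 0"
    using diff_pos_iff assms by simp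
  note \<psi> = urn_psi_properties[OF this]
  have "(\<lambda>n. M n - (a\<^sub>m / (1 - \<Lambda>) * real n + K * real n powr \<Lambda>)) \<in> O(\<lambda>n. real n powr 0)"
    by (rule mean_asymp) (use assms in auto)
  note * = linear_recursion_supercritical[OF assms S_Suc' \<psi>(2,1,3) urn_beta_asymp this]
  show "summable (\<lambda>j. large_index_summand model m \<sigma> a W\<^sub>0 (W\<^sub>0 + B\<^sub>0) M (Suc j))"
    using *(1) unfolding large_index_summand_def Let_def a\<^sub>m_def K_def .
  show "(\<lambda>n. V n - large_index_constant model m \<sigma> a W\<^sub>0 (W\<^sub>0 + B\<^sub>0) M * real n powr (2 * \<Lambda>)) \<in> O(\<lambda>n. real n)"
    using *(2) unfolding large_index_constant_def large_index_summand_def Let_def a\<^sub>m_def K_def V_def S_0 .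
qed

end

theorem theorem1:
  fixes P :: "'w measure"
    and model :: drawing_model
    and m \<sigma> W\<^sub>0 B\<^sub>0 :: nat
    and a b :: "nat \<Rightarrow> int"
    and X :: "nat \<Rightarrow> 'w \<Rightarrow> nat"
    and W B :: "nat \<Rightarrow> 'w \<Rightarrow> int"
  assumes "m \<ge> 1" and "\<sigma> \<ge> 1" and "W\<^sub>0 + B\<^sub>0 \<ge> m"
    and "balanced_urn m \<sigma> a b"
    and "tenable_urn model m a b"
    and "affine_urn m a"
    and "urn_process P model m a b W\<^sub>0 B\<^sub>0 X W B"
    and "int (W\<^sub>0 + B\<^sub>0) + int m * (a (m - 1) - a m) > 0"
  shows
    "let \<Lambda> = urn_index m \<sigma> a;
         E = (\<lambda>n. prob_space.expectation P (\<lambda>\<omega>. real_of_int (W n \<omega>)));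
         V = (\<lambda>n. prob_space.variance P (\<lambda>\<omega>. real_of_int (W n \<omega>)))
     in (\<Lambda> < 1/2 \<longrightarrow>
           (\<lambda>n. V n - a m * b 0 * \<Lambda>\<^sup>2 / (m * (1 - 2 * \<Lambda>) * (1 - \<Lambda>)\<^sup>2) * n) \<in> o(\<lambda>n. real n))
      \<and> (\<Lambda> = 1/2 \<longrightarrow>
           (\<lambda>n. V n - a m * b 0 / m * (n * ln (real n))) \<in> O(\<lambda>n. real n))
      \<and> (1/2 < \<Lambda> \<and> \<Lambda> < 1 \<longrightarrow>
           summable (\<lambda>j. large_index_summand model m \<sigma> a W\<^sub>0 (W\<^sub>0 + B\<^sub>0) E (Suc j)) \<and>
           (\<lambda>n. V n - large_index_constant model m \<sigma> a W\<^sub>0 (W\<^sub>0 + B\<^sub>0) E * n powr (2 * \<Lambda>))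
             \<in> O(\<lambda>n. real n))"
proof -
  interpret tenable_affine_urn P model m a b W\<^sub>0 B\<^sub>0 X W B \<sigma>
    using assms by (simp add: tenable_affine_urn_def tenable_affine_urn_axioms_def)
  have E: "(\<lambda>n. expectation (\<lambda>\<omega>. real_of_int (W n \<omega>))) = M"
    by (simp add: M_def[abs_def] U_def[abs_def])
  have V: "(\<lambda>n. variance (\<lambda>\<omega>. real_of_int (W n \<omega>))) = V"
    using variance_eq by (simp add: fun_eq_iff V_def U_def[abs_def])
  show ?thesis
    unfolding Let_def E V
  proof (intro conjI impI)
    assume "\<Lambda> < 1/2"
    then show "(\<lambda>n. V n - a m * b 0 * \<Lambda>\<^sup>2 / (m * (1 - 2 * \<Lambda>) * (1 - \<Lambda>)\<^sup>2) * n) \<in> o(\<lambda>n. real n)"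
      using variance_small_index by (simp add: a\<^sub>m_def mult_ac)
  next
    assume "\<Lambda> = 1/2"
    then show "(\<lambda>n. V n - a m * b 0 / m * (n * ln (real n))) \<in> O(\<lambda>n. real n)"
      using variance_critical_index by (simp add: a\<^sub>m_def)
  next
    assume "1/2 < \<Lambda> \<and> \<Lambda> < 1"
    then show "summable (\<lambda>j. large_index_summand model m \<sigma> a W\<^sub>0 (W\<^sub>0 + B\<^sub>0) M (Suc j))"
      and "(\<lambda>n. V n - large_index_constant model m \<sigma> a W\<^sub>0 (W\<^sub>0 + B\<^sub>0) M * n powr (2 * \<Lambda>)) \<in> O(\<lambda>n. real n)"
      using variance_large_index by auto
  qed
qed

end
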